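(* Consider the irreducible level $1$ highest weight $\widehat{gl}_{n|n}$-modules (with respect to the non-standard Borel subalgebra) $$L(\widehat{gl}_{n|n},\lambda\tilde\delta_1+\tilde\Lambda_0)\ \ (\lambda\in\mathbb Z,\ \lambda\ge0),\qquad L(\widehat{gl}_{n|n},(\lambda+1)\tilde\delta_n-\tilde\epsilon_n+\tilde\Lambda_0)\ \ (\lambda\in\mathbb Z,\ \lambda<0).$$ These modules are integrable. Furthermore, they form a complete list of integrable $\widehat{gl}_{n|n}$-modules of level $1$.
   Context: $gl_{n|n}$ is the general linear Lie superalgebra of $\mathbb C^{n|n}$, with even basis $e_1,\dots,e_n$ and odd basis $f_1,\dots,f_n$; its elements are block matrices $\begin{pmatrix}E&a\\ b&e\end{pmatrix}$, with elementary matrices $E_{ij},a_{ij},b_{ij},e_{ij}$ in the respective blocks, and $\mathrm{Str}=\mathrm{Tr}(E)-\mathrm{Tr}(e)$. Its Cartan subalgebra is $\mathfrak h=\sum_i\mathbb CE_{ii}+\sum_j\mathbb Ce_{jj}$. The non-standard Borel subalgebra of $gl_{n|n}$ is the one of matrices that are upper triangular with respect to the ordered basis $f_1<e_1<f_2<e_2<\dots<f_n<e_n$. $\widehat{gl}_{n|n}=gl_{n|n}\otimes\mathbb C[t,t^{-1}]+\mathbb CC+\mathbb Cd$ with $A(k)=A\otimes t^k$, $[A(k),B(l)]=[A,B](k+l)+\delta_{k+l,0}\,k\,\mathrm{Str}(AB)C$, $[d,A(k)]=kA(k)$, $C$ central. Its Cartan subalgebra is $\hat{\mathfrak h}=\mathfrak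 h+\mathbb CC+\mathbb Cd$. Define elements of $\hat{\mathfrak h}^*$: $\tilde\epsilon_i$ is dual to $E_{ii}$ and $\tilde\delta_j$ is dual to $e_{jj}$ (each zero on all other $E_{kk},e_{kk}$ and on $C,d$); $\tilde\Lambda_0(C)=1$, $\tilde\Lambda_0(\mathfrak h)=\tilde\Lambda_0(d)=0$. For a Borel subalgebra $B\supseteq\mathfrak h$ of $gl_{n|n}$, the corresponding Borel subalgebra of $\widehat{gl}_{n|n}$ is $B+\mathbb CC+\mathbb Cd+gl_{n|n}\otimes t\mathbb C[t]$; the non-standard Borel subalgebra of $\widehat{gl}_{n|n}$ is the one with $B$ the non-standard Borel subalgebra of $gl_{n|n}$. $L(\widehat{gl}_{n|n},\Lambda)$ denotes the irreducible highest weight module of highest weight $\Lambda$ with respect to the non-standard Borel subalgebra; its level is $\Lambda(C)$. Integrability is meant in the sense of Kac–Wakimoto (here for positive level): an irreducible highest weight $\widehat{gl}_{n|n}$-module is integrable if it is integrable over the affine algebra $\widehat{gl}_n$ of the upper-left block and over the finite-dimensional even subalgebra, i.e. if $E_{ij}(k)$ acts locally nilpotently for all $i\ne j$, $k\in\mathbb Z$, and $e_{ij}(0)$ acts locally nilpotently for all $i\neq j$.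
   Formalization: Completeness is proved for n ≥ 2 and up to tensoring with one-dimensional modules (A(k) → δ_{k,0} s Str A, C → 0, d → u): such twists of listed modules are also integrable of level 1, and for n = 1 integrability is a void condition. *)

theory Defs
  imports "HOL-Analysis.Analysis" "HOL-Library.Poly_Mapping"
begin

text \<open>
  The number $n \ge 1$ is the cardinality of a finite linearly ordered index type \<open>'n\<close>; the index
  $1$ is the minimum and the index $n$ the maximum of \<open>'n\<close>. The basis vector $e_i$ is indexed by
  \<open>Inl i\<close> and $f_j$ by \<open>Inr j\<close>. Parities are Booleans, \<open>True\<close> being odd.
\<close>

type_synonym 'n gl = "complex ^ ('n + 'n) ^ ('n + 'n)"

definition mscale :: "complex \<Rightarrow> ('n::finite) gl \<Rightarrow> 'n gl" where
  "mscale c A = (\<chi> p q. c * A $ p $ q)"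

definition elem :: "'n::finite + 'n \<Rightarrow> 'n + 'n \<Rightarrow> 'n gl" where
  "elem p q = (\<chi> r s. if r = p \<and> s = q then 1 else 0)"

definition gl_component :: "bool \<Rightarrow> ('n::finite) gl \<Rightarrow> 'n gl" where
  "gl_component a A = (\<chi> p q. if (isl p \<noteq> isl q) = a then A $ p $ q else 0)"

definition super_sign :: "bool \<Rightarrow> bool \<Rightarrow> real" where
  "super_sign a b = (if a \<and> b then - 1 else 1)"

definition gl_bracket :: "('n::finite) gl \<Rightarrow> 'n gl \<Rightarrow> 'n gl" where
  "gl_bracket A B = (\<Sum>a\<in>UNIV. \<Sum>b\<in>UNIV.
     gl_component a A ** gl_component b B
       - super_sign a b *\<^sub>R (gl_component b B ** gl_component a A))"

definition Str :: "('n::finite) gl \<Rightarrow> complex" where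
  "Str A = (\<Sum>i\<in>UNIV. A $ Inl i $ Inl i) - (\<Sum>j\<in>UNIV. A $ Inr j $ Inr j)"

text \<open>
  The triple $(f, c, d)$ stands for $\sum_k f_k \otimes t^k + c\,C + d\,d$.
\<close>

type_synonym 'n aff = "(int \<Rightarrow>\<^sub>0 'n gl) \<times> complex \<times> complex"

definition loop :: "('n::finite) gl \<Rightarrow> int \<Rightarrow> 'n aff" where
  "loop A k = (Poly_Mapping.single k A, 0, 0)"

definition central :: "('n::finite) aff" where
  "central = (0, 1, 0)"

definition deriv_d :: "('n::finite) aff" where
  "deriv_d = (0, 0, 1)"

definition ascale :: "complex \<Rightarrow> ('n::finite) aff \<Rightarrow> 'n aff" where
  "ascale s = (\<lambda>(f, c, d). (Poly_Mapping.map (mscale s) f, s * c, s * d))"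

definition euler :: "(int \<Rightarrow>\<^sub>0 ('n::finite) gl) \<Rightarrow> (int \<Rightarrow>\<^sub>0 'n gl)" where
  "euler f =
     (\<Sum>k\<in>Poly_Mapping.keys f. Poly_Mapping.single k (mscale (of_int k) (Poly_Mapping.lookup f k)))"

definition aff_bracket :: "('n::finite) aff \<Rightarrow> 'n aff \<Rightarrow> 'n aff" where
  "aff_bracket = (\<lambda>(f, c, d) (g, c', d').
     ((\<Sum>k\<in>Poly_Mapping.keys f. \<Sum>l\<in>Poly_Mapping.keys g.
         Poly_Mapping.single (k + l) (gl_bracket (Poly_Mapping.lookup f k) (Poly_Mapping.lookup g l)))
        + Poly_Mapping.map (mscale d) (euler g) - Poly_Mapping.map (mscale d') (euler f),
      (\<Sum>k\<in>Poly_Mapping.keys f. of_int k * Str (Poly_Mapping.lookup f k ** Poly_Mapping.lookup g (- k))),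
      0))"

definition aff_part :: "bool \<Rightarrow> ('n::finite) aff set" where
  "aff_part a =
     {(f, c, d). (\<forall>k. gl_component a (Poly_Mapping.lookup f k) = Poly_Mapping.lookup f k) \<and>
        (a \<longrightarrow> c = 0 \<and> d = 0)}"

lemma lookup_map_mscale [simp]:
  "Poly_Mapping.lookup (Poly_Mapping.map (mscale s) f) k = mscale s (Poly_Mapping.lookup f k)"
  by (auto simp: Poly_Mapping.map.rep_eq when_def mscale_def vec_eq_iff)

lemma map_mscale_single [simp]:
  "Poly_Mapping.map (mscale s) (Poly_Mapping.single k A) = Poly_Mapping.single k (mscale s A)"
  by (rule poly_mapping_eqI) (auto simp: Poly_Mapping.lookup_single when_def mscale_def vec_eq_iff)

lemma map_mscale_0 [simp]: "Poly_Mapping.map (mscale s) 0 = 0"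
  by (rule poly_mapping_eqI) (auto simp: mscale_def vec_eq_iff)

lemma mscale_simps [simp]: "mscale 1 A = A" "mscale 0 A = 0" "mscale s 0 = 0"
  by (auto simp: mscale_def vec_eq_iff)

lemma vector_space_ascale: "vector_space ascale"
  by unfold_locales
    (auto simp: ascale_def lookup_add mscale_def vec_eq_iff algebra_simps
      intro!: poly_mapping_eqI)

lemma gl_bracket_homogeneous:
  assumes "gl_component a A = A" and "gl_component b B = B"
  shows "gl_bracket A B = A ** B - super_sign a b *\<^sub>R (B ** A)"
proof -
  have other: "gl_component (\<not> c) X = 0" if "gl_component c X = X" for c and X :: "'a gl"
  proof -
    have "X $ p $ q = (if (isl p \<noteq> isl q) = c then X $ p $ q else 0)" for p q
      by (subst that [symmetric]) (simp add: gl_component_def)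
    then show ?thesis
      by (auto simp: gl_component_def vec_eq_iff) metis+
  qed
  show ?thesis
    using assms other [OF assms(1)] other [OF assms(2)]
    by (cases a; cases b) (auto simp: gl_bracket_def UNIV_bool)
qed

lemma gl_component_0 [simp]: "gl_component a 0 = 0"
  by (auto simp: gl_component_def vec_eq_iff)

lemma gl_bracket_0 [simp]: "gl_bracket 0 B = 0" "gl_bracket A 0 = 0"
  by (simp_all add: gl_bracket_def)

lemma aff_bracket_loop_loop:
  "aff_bracket (loop A k) (loop B l) =
     loop (gl_bracket A B) (k + l) +
       ascale (if k + l = 0 then of_int k * Str (A ** B) else 0) central"
proof -
  have [simp]: "euler 0 = 0"
    by (simp add: euler_def)
  have [simp]: "Poly_Mapping.map (mscale 0) f = 0" for f :: "int \<Rightarrow>\<^sub>0 'a gl"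
    by (rule poly_mapping_eqI) simp
  show ?thesis
    by (cases "A = 0"; cases "B = 0")
      (auto simp: aff_bracket_def loop_def ascale_def central_def lookup_single when_def Str_def
        keys_single)
qed

lemma aff_bracket_d_loop: "aff_bracket deriv_d (loop A k) = ascale (of_int k) (loop A k)"
proof -
  have "euler (Poly_Mapping.single k A) = Poly_Mapping.single k (mscale (of_int k) A)"
    by (cases "A = 0") (auto simp: euler_def)
  then show ?thesis
    by (simp add: aff_bracket_def loop_def ascale_def deriv_d_def euler_def)
qed

lemma aff_bracket_central: "aff_bracket central x = 0"
proof -
  have "Poly_Mapping.map (mscale 0) f = 0" for f :: "int \<Rightarrow>\<^sub>0 'a gl"
    by (rule poly_mapping_eqI) simp
  then show ?thesis
    by (cases x) (simp add: aff_bracket_def central_def euler_def zero_prod_def)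
qed

fun nonstd_le :: "'n::linorder + 'n \<Rightarrow> 'n + 'n \<Rightarrow> bool" where
  "nonstd_le (Inl i) (Inl j) \<longleftrightarrow> i \<le> j"
| "nonstd_le (Inr i) (Inr j) \<longleftrightarrow> i \<le> j"
| "nonstd_le (Inr i) (Inl j) \<longleftrightarrow> i \<le> j"
| "nonstd_le (Inl i) (Inr j) \<longleftrightarrow> i < j"

definition nonstd_borel :: "('n::{finite,linorder}) gl set" where
  "nonstd_borel = {A. \<forall>p q. A $ p $ q \<noteq> 0 \<longrightarrow> nonstd_le p q}"

definition aff_cartan :: "('n::finite) aff set" where
  "aff_cartan = {(Poly_Mapping.single 0 H, c, d) | H c d. \<forall>p q. p \<noteq> q \<longrightarrow> H $ p $ q = 0}"

definition aff_borel :: "('n::finite) gl set \<Rightarrow> 'n aff set" where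
  "aff_borel B = {(f, c, d). Poly_Mapping.lookup f 0 \<in> B \<and> (\<forall>k<0. Poly_Mapping.lookup f k = 0)}"

text \<open>The elements of the Borel subalgebra without component in the Cartan subalgebra.\<close>

definition aff_nilradical :: "('n::finite) gl set \<Rightarrow> 'n aff set" where
  "aff_nilradical B =
     {(f, c, d) \<in> aff_borel B. (\<forall>p. Poly_Mapping.lookup f 0 $ p $ p = 0) \<and> c = 0 \<and> d = 0}"

text \<open>
  Weights are given as functions on the whole algebra, of which only the restriction to
  \<^const>\<open>aff_cartan\<close> is ever used.
\<close>

type_synonym 'n weight = "'n aff \<Rightarrow> complex"

definition eps :: "'n::finite \<Rightarrow> 'n weight" where
  "eps i = (\<lambda>(f, c, d). Poly_Mapping.lookup f 0 $ Inl i $ Inl i)"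

definition delta :: "'n::finite \<Rightarrow> 'n weight" where
  "delta j = (\<lambda>(f, c, d). Poly_Mapping.lookup f 0 $ Inr j $ Inr j)"

definition Lambda0 :: "('n::finite) weight" where
  "Lambda0 = (\<lambda>(f, c, d). c)"

definition level :: "('n::finite) weight \<Rightarrow> complex" where
  "level \<Lambda> = \<Lambda> central"

definition listed_weights :: "('n::{finite,linorder}) weight set" where
  "listed_weights =
     {(\<lambda>h. of_int l * delta (Min UNIV) h + Lambda0 h) | l :: int. l \<ge> 0} \<union>
     {(\<lambda>h. of_int (l + 1) * delta (Max UNIV) h - eps (Max UNIV) h + Lambda0 h) | l :: int. l < 0}"

text \<open>
  A module is a complex vector space, namely the type \<open>'v\<close> with scalar multiplication \<open>sc\<close>, with a
  grading \<open>P\<close> by parity and an action \<open>\<rho>\<close>.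
\<close>

definition aff_module ::
  "(complex \<Rightarrow> 'v::ab_group_add \<Rightarrow> 'v) \<Rightarrow> (bool \<Rightarrow> 'v set) \<Rightarrow> (('n::finite) aff \<Rightarrow> 'v \<Rightarrow> 'v) \<Rightarrow> bool" where
  "aff_module sc P \<rho> \<longleftrightarrow>
     vector_space sc \<and>
     (\<forall>a. module.subspace sc (P a)) \<and>
     P False \<inter> P True = {0} \<and>
     (\<forall>v. \<exists>v0\<in>P False. \<exists>v1\<in>P True. v = v0 + v1) \<and>
     (\<forall>x. Vector_Spaces.linear sc sc (\<rho> x)) \<and>
     (\<forall>v. Vector_Spaces.linear ascale sc (\<lambda>x. \<rho> x v)) \<and>
     (\<forall>a b. \<forall>x\<in>aff_part a. \<forall>v\<in>P b. \<rho> x v \<in> P (a \<noteq> b)) \<and>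
     (\<forall>a b. \<forall>x\<in>aff_part a. \<forall>y\<in>aff_part b. \<forall>v.
        \<rho> (aff_bracket x y) v = \<rho> x (\<rho> y v) - sc (of_real (super_sign a b)) (\<rho> y (\<rho> x v)))"

definition graded_submodule ::
  "(complex \<Rightarrow> 'v::ab_group_add \<Rightarrow> 'v) \<Rightarrow> (bool \<Rightarrow> 'v set) \<Rightarrow> (('n::finite) aff \<Rightarrow> 'v \<Rightarrow> 'v) \<Rightarrow> 'v set \<Rightarrow> bool"
  where
  "graded_submodule sc P \<rho> W \<longleftrightarrow>
     module.subspace sc W \<and>
     (\<forall>w\<in>W. \<exists>w0\<in>W \<inter> P False. \<exists>w1\<in>W \<inter> P True. w = w0 + w1) \<and>
     (\<forall>x. \<forall>w\<in>W. \<rho> x w \<in> W)"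

definition irreducible_module ::
  "(complex \<Rightarrow> 'v::ab_group_add \<Rightarrow> 'v) \<Rightarrow> (bool \<Rightarrow> 'v set) \<Rightarrow> (('n::finite) aff \<Rightarrow> 'v \<Rightarrow> 'v) \<Rightarrow> bool" where
  "irreducible_module sc P \<rho> \<longleftrightarrow>
     aff_module sc P \<rho> \<and> (\<exists>v :: 'v. v \<noteq> 0) \<and>
     (\<forall>W. graded_submodule sc P \<rho> W \<longrightarrow> W = {0} \<or> W = UNIV)"

definition highest_weight_vector ::
  "(complex \<Rightarrow> 'v::ab_group_add \<Rightarrow> 'v) \<Rightarrow> (('n::finite) aff \<Rightarrow> 'v \<Rightarrow> 'v) \<Rightarrow> 'n gl set \<Rightarrow> 'n weight \<Rightarrow> 'v \<Rightarrow> bool"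
  where
  "highest_weight_vector sc \<rho> B \<Lambda> v \<longleftrightarrow>
     v \<noteq> 0 \<and> (\<forall>x\<in>aff_nilradical B. \<rho> x v = 0) \<and> (\<forall>h\<in>aff_cartan. \<rho> h v = sc (\<Lambda> h) v)"

text \<open>
  \<open>is_L sc P \<rho> \<Lambda>\<close> says that the module is (a copy of) $L(\widehat{gl}_{n|n},\Lambda)$. By irreducibility
  the highest weight vector generates the module.
\<close>

definition is_L ::
  "(complex \<Rightarrow> 'v::ab_group_add \<Rightarrow> 'v) \<Rightarrow> (bool \<Rightarrow> 'v set) \<Rightarrow> (('n::{finite,linorder}) aff \<Rightarrow> 'v \<Rightarrow> 'v)
     \<Rightarrow> 'n weight \<Rightarrow> bool" where
  "is_L sc P \<rho> \<Lambda> \<longleftrightarrow>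
     irreducible_module sc P \<rho> \<and>
     (\<exists>v\<in>P False \<union> P True. highest_weight_vector sc \<rho> nonstd_borel \<Lambda> v)"

definition locally_nilpotent :: "('v::zero \<Rightarrow> 'v) \<Rightarrow> bool" where
  "locally_nilpotent T \<longleftrightarrow> (\<forall>v. \<exists>N. (T ^^ N) v = 0)"

definition integrable_module :: "(('n::finite) aff \<Rightarrow> 'v::zero \<Rightarrow> 'v) \<Rightarrow> bool" where
  "integrable_module \<rho> \<longleftrightarrow>
     (\<forall>i j k. i \<noteq> j \<longrightarrow> locally_nilpotent (\<rho> (loop (elem (Inl i) (Inl j)) k))) \<and>
     (\<forall>i j. i \<noteq> j \<longrightarrow> locally_nilpotent (\<rho> (loop (elem (Inr i) (Inr j)) 0)))"

text \<open>
  Tensoring with a one-dimensional (even) module on which $x$ acts by $\theta(x)$, such as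
  $\theta(A(k)) = \delta_{k,0}\,s\,\mathrm{Str}(A)$, $\theta(C) = 0$, $\theta(d) = u$.
  This changes neither irreducibility, level nor integrability, so any list of integrable modules can
  be complete only up to it.
\<close>

definition one_dimensional :: "(('n::finite) aff \<Rightarrow> complex) \<Rightarrow> bool" where
  "one_dimensional \<theta> \<longleftrightarrow>
     aff_module (*) (\<lambda>a. if a then {0} else UNIV) (\<lambda>x z. \<theta> x * z)"

definition tensor_one ::
  "(complex \<Rightarrow> 'v::ab_group_add \<Rightarrow> 'v) \<Rightarrow> (('n::finite) aff \<Rightarrow> complex) \<Rightarrow> ('n aff \<Rightarrow> 'v \<Rightarrow> 'v)
     \<Rightarrow> ('n aff \<Rightarrow> 'v \<Rightarrow> 'v)" where
  "tensor_one sc \<theta> \<rho> = (\<lambda>x v. \<rho> x v + sc (\<theta> x) v)"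

end

theory Submission
  imports Defs
begin

text \<open>
  Order the loop vectors $e_i t^k$, $f_j t^k$ by a function $T$. In the Fock space of fermions $e$ and
  bosons $f$, the sea filled with all fermions of positive energy, with $l$ bosons in one mode of
  energy $0$, is killed by every non-Cartan root vector that does not lower the energy. In an
  irreducible module, every homogeneous singular vector of lower degree than some other eigenvector
  of the degree operator vanishes; this shows that highest weight vectors of the listed weights obey
  the same relations, and that so does the vector obtained by turning a fermion $e_j t^m$ at the Fermi
  level into a boson. Emptying enough modes of $e_j$ produces a nonzero vector killed by
  $E_{ij}(-k)$, which suffices because the vectors on which an ad-nilpotent element is nilpotent form
  a submodule. The second family is reduced to the first by the supertranspose automorphism.

  Conversely, an odd reflection shows that for a positive even root which is the sum of two odd ones
  the label is a natural number and vanishes only together with the label of the odd root. As the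
  labels of the affine $gl_n$ sum up to the level $1$, all but one of them vanish, and the
  integrability over the other $gl_n$ forces the exceptional one to sit next to $f_1$ or $f_n$.
\<close>

subsection \<open>Singular vectors at level one\<close>

definition supersign :: "('n + 'n) \<Rightarrow> complex" where
  "supersign p = (if isl p then 1 else - 1)"

definition comm_sign :: "('n + 'n) \<Rightarrow> 'n + 'n \<Rightarrow> 'n + 'n \<Rightarrow> 'n + 'n \<Rightarrow> complex" where
  "comm_sign p q a b = (if isl p \<noteq> isl q \<and> isl a \<noteq> isl b then - 1 else 1)"

text \<open>The degree of \<open>elem p q\<close> at t^k when the loop vector p t^k has degree
  \<open>D p + M * k\<close>. Different \<open>D\<close> and \<open>M\<close> describe different
  triangular decompositions.\<close>

definition deg :: "('n + 'n \<Rightarrow> int) \<Rightarrow> int \<Rightarrow> 'n + 'n \<Rightarrow> 'n + 'n \<Rightarrow> int \<Rightarrow> int" where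
  "deg D M p q k = D p - D q + M * k"

lemma minus_one_in_Nats: "(- 1 :: 'a::{ring_char_0}) \<notin> \<nat>"
proof
  assume "(- 1 :: 'a) \<in> \<nat>"
  then obtain n where "(of_nat n :: 'a) = - 1" by (auto elim: Nats_cases)
  then have "(of_nat (Suc n) :: 'a) = 0" by simp
  then show False by (simp only: of_nat_eq_0_iff)
qed

text \<open>Composing the operators \<open>L - g\<close> over the eigenvalues in a finite
  combination kills \<open>w\<close>; but the composite scales \<open>w\<close> by the product of
  the \<open>c - g\<close>, so one factor vanishes.\<close>

lemma (in vector_space) eigenvalue_in_span:
  assumes L: "Vector_Spaces.linear scale scale L"
    and B: "\<And>b. b \<in> B \<Longrightarrow> \<exists>g\<in>G. L b = scale g b"
    and w: "w \<in> span B" "L w = scale c w" "w \<noteq> 0"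
  shows "c \<in> G"
proof -
  interpret L: Vector_Spaces.linear scale scale L by (rule L)
  define op where "op g u = L u - scale g u" for g u
  have op_add: "op g (x + y) = op g x + op g y" for g x y
    by (simp add: op_def L.add scale_right_distrib)
  have op_scale: "op g (scale s x) = scale s (op g x)" for g s x
    by (simp add: op_def L.scale scale_right_diff_distrib mult.commute)
  have op_comm: "op g (op h x) = op h (op g x)" for g h x
    by (simp add: op_def L.diff L.scale scale_right_diff_distrib mult.commute)
  have F_add: "foldr op gs (x + y) = foldr op gs x + foldr op gs y" for gs x y
    by (induction gs) (simp_all add: op_add)
  have F_scale: "foldr op gs (scale s x) = scale s (foldr op gs x)" for gs s x
    by (induction gs) (simp_all add: op_scale)
  have F_comm: "op g (foldr op gs x) = foldr op gs (op g x)" for g gs x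
    by (induction gs) (simp_all, metis op_comm)
  have op_0: "op g 0 = 0" for g
    by (simp add: op_def L.zero)
  have F_0: "foldr op gs 0 = 0" for gs
    by (induction gs) (simp_all add: op_0)
  have "\<exists>gs. set gs \<subseteq> G \<and> foldr op gs w = 0"
    using w(1)
  proof (induction rule: span_induct_alt)
    case base
    then show ?case by (intro exI[of _ "[]"]) simp
  next
    case (step s b y)
    then obtain gs g where *: "set gs \<subseteq> G" "foldr op gs y = 0" "g \<in> G" "L b = scale g b"
      using B by blast
    have "foldr op (g # gs) (scale s b + y) = op g (foldr op gs (scale s b))"
      using * by (simp add: F_add)
    also have "\<dots> = scale s (foldr op gs (op g b))"
      by (simp add: F_scale op_scale F_comm)
    also have "\<dots> = 0"
      using * by (simp add: op_def F_0)
    finally show ?case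
      using * by (intro exI[of _ "g # gs"]) simp
  qed
  then obtain gs where gs: "set gs \<subseteq> G" "foldr op gs w = 0"
    by blast
  have "foldr op gs w = scale (\<Prod>g\<leftarrow>gs. c - g) w" for gs
  proof (induction gs)
    case (Cons g gs)
    have "op g (scale s w) = scale (s * (c - g)) w" for s
      by (simp add: op_def L.scale w(2) scale_left_diff_distrib algebra_simps)
    then show ?case using Cons by (simp add: mult.commute)
  qed simp
  then have "(\<Prod>g\<leftarrow>gs. c - g) = 0"
    using gs(2) w(3) by simp
  then have "\<exists>g\<in>set gs. c - g = 0"
    by (induction gs) auto
  then show ?thesis using gs(1) by auto
qed

text \<open>Only the action of the matrix units and of d is kept, with C acting as 1. Irreducibility
  enters through \<open>generate\<close>, where \<open>Hom\<close> stands for the homogeneous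
  vectors. In this form a twist by an automorphism of the algebra can be a further instance.\<close>

locale level_one_rep = vector_space sc
  for sc :: "complex \<Rightarrow> 'v::ab_group_add \<Rightarrow> 'v" +
  fixes X :: "'n::finite + 'n \<Rightarrow> 'n + 'n \<Rightarrow> int \<Rightarrow> 'v \<Rightarrow> 'v"
    and d :: "'v \<Rightarrow> 'v"
    and Hom :: "'v set"
  assumes X_linear: "Vector_Spaces.linear sc sc (X p q k)"
    and d_linear: "Vector_Spaces.linear sc sc d"
    and comm: "X p q k (X a b l v) =
      sc (comm_sign p q a b) (X a b l (X p q k v))
      + (if q = a then X p b (k + l) v else 0)
      - sc (comm_sign p q a b) (if b = p then X a q (k + l) v else 0)
      + sc (if q = a \<and> b = p \<and> k + l = 0 then of_int k * supersign p else 0) v"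
    and d_comm: "d (X p q k v) = X p q k (d v) + sc (of_int k) (X p q k v)"
    and Hom_scale: "w \<in> Hom \<Longrightarrow> sc c w \<in> Hom"
    and Hom_X: "w \<in> Hom \<Longrightarrow> X p q k w \<in> Hom"
    and generate: "\<lbrakk>w \<in> Hom; w \<noteq> 0; subspace W; w \<in> W; \<And>p q k u. u \<in> W \<Longrightarrow> X p q k u \<in> W;
      \<And>u. u \<in> W \<Longrightarrow> d u \<in> W\<rbrakk> \<Longrightarrow> u \<in> W"
begin

section \<open>Degree operators and orbits of singular vectors\<close>

lemma X_simps:
  "X p q k (u + v) = X p q k u + X p q k v"
  "X p q k (u - v) = X p q k u - X p q k v"
  "X p q k (sc c u) = sc c (X p q k u)"
  "X p q k (- u) = - X p q k u"
  "X p q k 0 = 0"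
  "X p q k (sum g S) = (\<Sum>s\<in>S. X p q k (g s))"
proof -
  interpret X: Vector_Spaces.linear sc sc "X p q k" by (rule X_linear)
  show "X p q k (u + v) = X p q k u + X p q k v"
    "X p q k (u - v) = X p q k u - X p q k v"
    "X p q k (sc c u) = sc c (X p q k u)"
    "X p q k (- u) = - X p q k u"
    "X p q k 0 = 0"
    "X p q k (sum g S) = (\<Sum>s\<in>S. X p q k (g s))"
    by (simp_all add: X.add X.diff X.scale X.neg X.zero X.sum)
qed

lemma d_simps:
  "d (u + v) = d u + d v" "d (sc c u) = sc c (d u)" "d 0 = 0"
proof -
  interpret d: Vector_Spaces.linear sc sc d by (rule d_linear)
  show "d (u + v) = d u + d v" "d (sc c u) = sc c (d u)" "d 0 = 0"
    by (simp_all add: d.add d.scale d.zero)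
qed

text \<open>The Cartan element whose adjoint action on \<open>X p q k\<close> is multiplication by
  \<open>deg D M p q k\<close>; see \<open>grade_X\<close>.\<close>

definition grade :: "('n + 'n \<Rightarrow> int) \<Rightarrow> int \<Rightarrow> 'v \<Rightarrow> 'v" where
  "grade D M w = sc (of_int M) (d w) + (\<Sum>p\<in>UNIV. sc (of_int (D p)) (X p p 0 w))"

lemma cartan_X:
  "X a a 0 (X p q k w) =
     X p q k (X a a 0 w) + sc ((if a = p then 1 else 0) - (if a = q then 1 else 0)) (X p q k w)"
  by (subst comm) (auto simp: comm_sign_def scale_left_diff_distrib)

lemma grade_linear: "Vector_Spaces.linear sc sc (grade D M)"
  by unfold_locales
    (auto simp: grade_def X_simps d_simps scale_right_distrib sum.distrib scale_sum_right mult.commute)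

lemma grade_d: "grade D M (d w) = d (grade D M w)"
proof -
  interpret d: Vector_Spaces.linear sc sc d by (rule d_linear)
  show ?thesis
    by (simp add: grade_def d_simps d.sum d_comm)
qed

lemma grade_X:
  "grade D M (X p q k w) = X p q k (grade D M w) + sc (of_int (deg D M p q k)) (X p q k w)"
proof -
  have "(\<Sum>a\<in>UNIV. sc (of_int (D a)) (X a a 0 (X p q k w))) =
      (\<Sum>a\<in>UNIV. sc (of_int (D a)) (X p q k (X a a 0 w)))
      + (\<Sum>a\<in>UNIV. if a = p then sc (of_int (D a)) (X p q k w) else 0)
      - (\<Sum>a\<in>UNIV. if a = q then sc (of_int (D a)) (X p q k w) else 0)"
    unfolding sum.distrib[symmetric] sum_subtractf[symmetric]
    by (intro sum.cong refl) (auto simp: cartan_X scale_right_distrib)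
  also have "\<dots> = (\<Sum>a\<in>UNIV. sc (of_int (D a)) (X p q k (X a a 0 w)))
      + sc (of_int (D p)) (X p q k w) - sc (of_int (D q)) (X p q k w)"
    by simp
  finally show ?thesis
    by (simp add: grade_def d_comm X_simps deg_def scale_left_distrib scale_left_diff_distrib
        scale_right_distrib algebra_simps)
qed

text \<open>Words of non-raising operators applied to \<open>w\<close>; their span replaces the
  triangular decomposition of an enveloping algebra.\<close>

inductive_set orbit :: "('n + 'n \<Rightarrow> int) \<Rightarrow> int \<Rightarrow> 'v \<Rightarrow> 'v set" for D M w where
  base: "w \<in> orbit D M w"
| lower: "u \<in> orbit D M w \<Longrightarrow> deg D M p q k \<le> 0 \<Longrightarrow> X p q k u \<in> orbit D M w"
| d: "u \<in> orbit D M w \<Longrightarrow> d u \<in> orbit D M w"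

lemma span_stable:
  assumes f: "Vector_Spaces.linear sc sc f" and S: "\<And>u. u \<in> S \<Longrightarrow> f u \<in> span S"
    and u: "u \<in> span S"
  shows "f u \<in> span S"
proof -
  interpret f: Vector_Spaces.linear sc sc f by (rule f)
  show ?thesis
    using u by (induction rule: span_induct_alt)
      (auto simp: f.add f.scale f.zero intro: span_add span_scale span_zero S)
qed

text \<open>The operator is commuted past the outermost letter of the word. The corrections are
  single operators or scalars applied to a shorter word, so induction for all \<open>p q k\<close>
  at once suffices.\<close>

lemma raising_orbit:
  assumes sing: "\<And>p q k. deg D M p q k > 0 \<Longrightarrow> X p q k w = 0"
    and u: "u \<in> orbit D M w"
  shows "X p q k u \<in> span (orbit D M w)"
proof -
  let ?S = "orbit D M w"
  have d_span: "d y \<in> span ?S" if "y \<in> span ?S" for y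
    using d_linear _ that by (rule span_stable) (auto intro: span_base orbit.d)
  have low_span: "X a b l y \<in> span ?S" if "y \<in> span ?S" "deg D M a b l \<le> 0" for y a b l
    using X_linear _ that(1) by (rule span_stable) (auto intro: span_base orbit.lower that)
  show ?thesis
    using u
  proof (induction arbitrary: p q k)
    case base
    show ?case
      using sing low_span[OF span_base[OF orbit.base]] by (cases "deg D M p q k > 0") (auto simp: span_zero)
  next
    case (lower u a b l)
    have "X a b l (X p q k u) \<in> span ?S"
      by (rule low_span[OF lower.IH lower.hyps(2)])
    then show ?case
      by (subst comm, intro span_add span_diff span_scale)
        (simp_all add: lower.IH span_zero span_base[OF lower.hyps(1)])
  next
    case (d u)
    have "X p q k (d u) = d (X p q k u) - sc (of_int k) (X p q k u)"
      by (simp add: d_comm)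
    then show ?case
      by (auto intro!: span_diff span_scale d_span d.IH)
  qed
qed

lemma orbit_eigen:
  assumes "grade D M w = sc c w" "u \<in> orbit D M w"
  shows "\<exists>m::nat. grade D M u = sc (c - of_nat m) u"
  using assms(2)
proof induction
  case base
  then show ?case using assms(1) by (intro exI[of _ 0]) simp
next
  case (lower u p q k)
  then obtain m where "grade D M u = sc (c - of_nat m) u" by blast
  then have "grade D M (X p q k u) = sc (c - of_nat m + of_int (deg D M p q k)) (X p q k u)"
    by (simp add: grade_X X_simps scale_left_distrib)
  then show ?case
    using lower.hyps(2)
    by (intro exI[of _ "m + nat (- deg D M p q k)"]) (simp add: of_nat_nat)
next
  case (d u)
  then show ?case by (metis grade_d d_simps(2))
qed

text \<open>For nonzero \<open>w\<close> the span of its orbit is stable, hence everything, and has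
  only degrees \<open>c - n\<close> with natural n; the degree of \<open>u\<close> exceeds
  \<open>c\<close>.\<close>

lemma no_lower_singular:
  assumes "w \<in> Hom" and sing: "\<And>p q k. deg D M p q k > 0 \<Longrightarrow> X p q k w = 0"
    and w: "grade D M w = sc c w"
    and u: "grade D M u = sc (c + of_int m) u" "u \<noteq> 0" "m > 0"
  shows "w = 0"
proof (rule ccontr)
  assume "w \<noteq> 0"
  have "u \<in> span (orbit D M w)"
  proof (rule generate[OF assms(1) \<open>w \<noteq> 0\<close>])
    show "w \<in> span (orbit D M w)"
      by (rule span_base[OF orbit.base])
    show "X p q k y \<in> span (orbit D M w)" if "y \<in> span (orbit D M w)" for p q k y
      using X_linear _ that by (rule span_stable) (auto intro: raising_orbit sing)
    show "d y \<in> span (orbit D M w)" if "y \<in> span (orbit D M w)" for y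
      using d_linear _ that by (rule span_stable) (auto intro: span_base orbit.d)
  qed auto
  then have "c + of_int m \<in> {c - of_nat n | n :: nat. True}"
    using orbit_eigen[OF w] by (intro eigenvalue_in_span[OF grade_linear _ _ u(1,2)]) auto
  then obtain n :: nat where "(of_int m :: complex) = - of_nat n"
    by auto
  then have "m = - int n"
    by (metis of_int_eq_iff of_int_minus of_int_of_nat_eq)
  then show False using u(3) by simp
qed

section \<open>Vacuum vectors and their relations\<close>

definition singular :: "('n + 'n \<Rightarrow> int) \<Rightarrow> int \<Rightarrow> 'v \<Rightarrow> bool" where
  "singular D M u \<longleftrightarrow>
     (\<forall>p q k. deg D M p q k \<ge> 0 \<longrightarrow> \<not> (p = q \<and> k = 0) \<longrightarrow> X p q k u = 0)"

lemma singularD: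
  "singular D M u \<Longrightarrow> deg D M p q k \<ge> 0 \<Longrightarrow> p \<noteq> q \<or> k \<noteq> 0 \<Longrightarrow> X p q k u = 0"
  by (auto simp: singular_def)

text \<open>
  The weight of the vacuum in which the fermion modes $e_p t^k$ are filled exactly if
  $T(e_p) + 2k > 0$ and the mode \<open>z\<close> contains \<open>l\<close> bosons.
\<close>

definition vacuum_weight :: "'n + 'n \<Rightarrow> ('n + 'n \<Rightarrow> int) \<Rightarrow> nat \<Rightarrow> 'v \<Rightarrow> bool" where
  "vacuum_weight z T l u \<longleftrightarrow> u \<in> Hom \<and> u \<noteq> 0 \<and> T z = 0 \<and> (\<forall>p. p \<noteq> z \<longrightarrow> odd (T p)) \<and>
     X z z 0 u = sc (of_nat l) u \<and>
     (\<forall>p. p \<noteq> z \<longrightarrow> X p p 0 u = sc (supersign p * (of_int (T p) + 1) / 2) u) \<and>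
     (\<exists>c. d u = sc c u)"

lemma vacuum_weight_grade:
  assumes "vacuum_weight z T l u"
  shows "\<exists>c. grade D M u = sc c u"
proof -
  have "\<exists>\<mu>. X p p 0 u = sc \<mu> u" for p
    using assms unfolding vacuum_weight_def by (cases "p = z") blast+
  then obtain \<mu> where \<mu>: "X p p 0 u = sc (\<mu> p) u" for p
    by metis
  obtain c where c: "d u = sc c u"
    using assms by (auto simp: vacuum_weight_def)
  show ?thesis
    unfolding grade_def c \<mu> scale_scale scale_sum_left[symmetric] scale_left_distrib[symmetric]
    by blast
qed

text \<open>The relations missing for \<open>T\<close> concern root vectors of
  \<open>T\<close>-degree 0 and negative \<open>D\<close>-degree. The weight in
  \<open>vacuum_weight\<close> makes their coroots vanish, so they map \<open>u\<close> to vectors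
  killed by everything of positive \<open>D\<close>-degree, which are 0 by
  \<open>no_lower_singular\<close>.\<close>

lemma coarsen:
  assumes vac: "vacuum_weight z T l u" and D: "singular D M u"
    and le: "\<And>p q k. deg D M p q k > 0 \<Longrightarrow> deg T 2 p q k \<ge> 0"
  shows "singular T 2 u"
proof -
  have neg: "deg D M q p (- k) = - deg D M p q k" "deg T 2 q p (- k) = - deg T 2 p q k" for p q k
    by (simp_all add: deg_def)
  obtain c where c: "grade D M u = sc c u"
    using vacuum_weight_grade[OF vac] by blast
  have u: "u \<in> Hom" "u \<noteq> 0"
    using vac by (auto simp: vacuum_weight_def)
  have main: "X p q k u = 0" if "deg D M p q k < 0" "deg T 2 p q k = 0" for p q k
    using that
  \<comment> \<open>Induction on the depth below degree 0: raising \<open>X p q k u\<close> leads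
    only to root vectors closer to degree 0.\<close>
  proof (induction "nat (- deg D M p q k)" arbitrary: p q k rule: less_induct)
    case less
    have pq: "p \<noteq> q"
    proof
      assume "p = q"
      then have "k = 0" using less.prems(2) by (simp add: deg_def)
      then show False using less.prems(1) \<open>p = q\<close> by (simp add: deg_def)
    qed
    \<comment> \<open>A root of \<open>T\<close>-degree 0 cannot involve \<open>z\<close>, since
      \<open>T z\<close> is even and all other values of \<open>T\<close> are odd.\<close>
    have z: "p \<noteq> z" "q \<noteq> z"
    proof -
      have "even (T p - T q)"
        using less.prems(2) by (simp add: deg_def) presburger
      then show "p \<noteq> z" "q \<noteq> z"
        using vac pq unfolding vacuum_weight_def by (metis diff_0 diff_zero dvd_minus_iff)+
    qed
    have raise: "X a b m (X p q k u) = 0" if pos: "deg D M a b m > 0" for a b m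
    proof (cases "a = q \<and> b = p \<and> m + k = 0")
      case True
      then have [simp]: "a = q" "b = p" "m = - k" by auto
      have kill: "X q p (- k) u = 0"
        using singularD[OF D, of q p "- k"] neg less.prems pq by auto
      have T: "of_int (T p) - of_int (T q) + 2 * of_int k = (0 :: complex)"
        using less.prems(2) unfolding deg_def by (metis of_int_0 of_int_add of_int_diff of_int_mult of_int_numeral)
      \<comment> \<open>Opposite root vectors bracket to a coroot; its value on \<open>u\<close> is,
        up to sign, half of \<open>deg T 2 p q k\<close>, which is 0.\<close>
      have "X q p (- k) (X p q k u) =
          sc (supersign q * (of_int (T q) + 1) / 2
              - comm_sign q p p q * (supersign p * (of_int (T p) + 1) / 2) - of_int k * supersign q) u"
        using vac z by (subst comm) (simp add: kill X_simps vacuum_weight_def scale_left_diff_distrib)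
      also have "supersign q * (of_int (T q) + 1) / 2
            - comm_sign q p p q * (supersign p * (of_int (T p) + 1) / 2) - of_int k * supersign q
          = - supersign q * (of_int (T p) - of_int (T q) + 2 * of_int k) / 2"
        by (simp add: comm_sign_def supersign_def field_simps)
      also have "\<dots> = 0" using T by simp
      finally show ?thesis by simp
    next
      case False
      have T: "deg T 2 a b m \<ge> 0" using le pos by blast
      have kill: "X r s j u = 0"
        if "deg D M r s j = deg D M a b m + deg D M p q k" "deg T 2 r s j = deg T 2 a b m"
          "r \<noteq> s \<or> j \<noteq> 0" for r s j
      proof (cases "deg D M r s j \<ge> 0")
        case True
        then show ?thesis using D that(3) by (auto intro: singularD)
      next
        case neg': False
        \<comment> \<open>The opposite root has positive \<open>D\<close>-degree, hence
          \<open>T\<close>-degree at least 0. Both bounds together force \<open>T\<close>-degree 0,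
          and the induction hypothesis applies.\<close>
        then have "deg T 2 s r (- j) \<ge> 0"
          by (intro le) (simp add: neg)
        then have "deg T 2 r s j = 0"
          using that(2) T neg[where p = r and q = s and k = j] by simp
        then show ?thesis
          using neg' that(1) pos by (intro less.hyps) auto
      qed
      have "X a b m u = 0"
        using pos by (intro singularD[OF D]) (auto simp: deg_def)
      moreover have "b = p \<Longrightarrow> X a q (m + k) u = 0"
        using less.prems False by (intro kill) (auto simp: deg_def algebra_simps)
      moreover have "a = q \<Longrightarrow> X p b (m + k) u = 0"
        using less.prems False by (intro kill) (auto simp: deg_def algebra_simps)
      ultimately show ?thesis
        using False by (subst comm) (auto simp: X_simps)
    qed
    have "grade D M (X p q k u) = sc (c - of_int (- deg D M p q k)) (X p q k u)"
      by (simp add: grade_X c X_simps scale_left_distrib)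
    moreover have "grade D M u = sc (c - of_int (- deg D M p q k) + of_int (- deg D M p q k)) u"
      by (simp add: c)
    ultimately show ?case
      using less.prems(1) u(2)
      by (intro no_lower_singular[OF Hom_X[OF u(1)] raise, where m = "- deg D M p q k"]) auto
  qed
  show ?thesis
    unfolding singular_def
  proof (intro allI impI)
    fix p q k assume T: "deg T 2 p q k \<ge> 0" and ne: "\<not> (p = q \<and> k = 0)"
    show "X p q k u = 0"
    proof (cases "deg D M p q k \<ge> 0")
      case True
      then show ?thesis using D ne by (auto intro: singularD)
    next
      case False
      then have "deg T 2 q p (- k) \<ge> 0"
        by (intro le) (simp add: neg)
      then show ?thesis
        using main[of p q k] False T neg[where p = p and q = q and k = k] by simp
    qed
  qed
qed

text \<open>With \<open>T j = 1 - 2 * m\<close> the mode j t^m is the filled one next to the Fermi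
  level. \<open>X z j (- m)\<close> empties it and adds a boson at \<open>z\<close>; the opposite
  operator returns \<open>Suc l\<close> times \<open>u\<close>, so the result is nonzero.\<close>

lemma move_fermion:
  assumes vac: "vacuum_weight z T l u" and u: "singular T 2 u"
    and zj: "\<not> isl z" "isl j"
  obtains u' where "vacuum_weight z (T(j := T j - 2)) (Suc l) u'" "singular (T(j := T j - 2)) 2 u'"
proof -
  have jz: "j \<noteq> z" using zj by auto
  then have "odd (T j)" using vac by (simp add: vacuum_weight_def)
  then obtain m where m: "T j = 1 - 2 * m"
    by (metis add_diff_cancel_left' diff_minus_eq_add minus_mult_right oddE uminus_add_conv_diff)
  have Tz: "T z = 0" and odd: "p \<noteq> z \<Longrightarrow> odd (T p)" for p
    using vac by (auto simp: vacuum_weight_def)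
  define w where "w = X z j (- m) u"
  define T' where "T' = T(j := T j - 2)"
  \<comment> \<open>A refinement of the new grading: in doubled degrees j t^m moves from 2 to -1,
    just below \<open>z\<close> at 0 but still above the other modes at -2, where \<open>T'\<close>
    will put it.\<close>
  define D where "D p = (if p = j then 2 * T j - 3 else 2 * T p)" for p
  have "X z z 0 u = sc (of_nat l) u" "X j j 0 u = sc ((of_int (T j) + 1) / 2) u"
    using vac jz zj by (simp_all add: vacuum_weight_def supersign_def)
  moreover have "X j z m u = 0"
    using jz Tz m by (intro singularD[OF u]) (auto simp: deg_def)
  ultimately have "X j z m w = sc (of_nat (Suc l)) u"
    using jz zj m
    unfolding w_def
    by (subst comm, simp add: comm_sign_def supersign_def X_simps,
        simp only: scale_left_distrib[symmetric] scale_left_diff_distrib[symmetric])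
      (simp add: add_divide_distrib diff_divide_distrib scale_left_distrib)
  moreover have "u \<noteq> 0"
    using vac by (simp add: vacuum_weight_def)
  moreover have "(of_nat (Suc l) :: complex) \<noteq> 0"
    by (simp only: of_nat_eq_0_iff)
  ultimately have "w \<noteq> 0"
    by (auto simp: X_simps)
  have vac': "vacuum_weight z T' (Suc l) w"
    unfolding vacuum_weight_def
  proof (intro conjI allI impI)
    show "w \<in> Hom"
      using vac by (auto simp: w_def vacuum_weight_def Hom_X)
    show "w \<noteq> 0" by fact
    show "T' z = 0" "p \<noteq> z \<Longrightarrow> odd (T' p)" for p
      using Tz odd jz by (auto simp: T'_def)
    show "X z z 0 w = sc (of_nat (Suc l)) w"
      using vac jz by (auto simp: w_def cartan_X X_simps vacuum_weight_def scale_left_distrib)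
    show "X p p 0 w = sc (supersign p * (of_int (T' p) + 1) / 2) w" if "p \<noteq> z" for p
      using vac that jz zj
      by (auto simp: w_def T'_def cartan_X X_simps vacuum_weight_def supersign_def
          scale_left_distrib[symmetric] scale_left_diff_distrib[symmetric] diff_divide_distrib add_divide_distrib)
    obtain c where "d u = sc c u"
      using vac by (auto simp: vacuum_weight_def)
    then have "d w = sc (c - of_int m) w"
      by (simp add: w_def d_comm X_simps scale_left_diff_distrib)
    then show "\<exists>c. d w = sc c w" by blast
  qed
  have "singular D 4 w"
    unfolding singular_def
  proof (intro allI impI)
    fix p q r assume D: "deg D 4 p q r \<ge> 0" and "\<not> (p = q \<and> r = 0)"
    then have ne: "p \<noteq> q \<or> r \<noteq> 0" by simp
    show "X p q r w = 0"
    \<comment> \<open>This operator has become raising for \<open>D\<close> but need not kill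
      \<open>u\<close>; it kills \<open>w\<close> because it is odd and squares to zero.\<close>
    proof (cases "p = z \<and> q = j \<and> r = - m")
      case True
      have "w' = 0" if "w' = sc (- 1) w'" for w' :: 'v
      proof -
        have "sc 2 w' = w' + w'" by (simp add: scale_left_distrib[of 1 1, simplified])
        also have "\<dots> = 0" using that by (metis scale_minus_left scale_one add.right_inverse)
        finally show ?thesis by simp
      qed
      moreover have "X z j (- m) w = sc (- 1) (X z j (- m) w)"
        unfolding w_def
        by (subst comm) (use zj jz in \<open>auto simp: comm_sign_def X_simps\<close>)
      ultimately show ?thesis using True by blast
    next
      case False
      have par: "p \<noteq> z \<Longrightarrow> \<exists>x. T p = 2 * x + 1" for p
        using odd by (metis oddE)
      have "X p q r u = 0"
      proof (rule singularD[OF u _ ne])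
        show "deg T 2 p q r \<ge> 0"
          using D False par[of p] par[of q] Tz m unfolding deg_def D_def
          by (cases "p = z"; cases "q = z"; auto split: if_splits; presburger?)
      qed
      moreover have "X p j (r - m) u = 0" if "q = z"
      proof (rule singularD[OF u])
        show "deg T 2 p j (r - m) \<ge> 0" "p \<noteq> j \<or> r - m \<noteq> 0"
          using D False par[of p] Tz m jz ne that unfolding deg_def D_def
          by (cases "p = z"; auto split: if_splits; presburger?)+
      qed
      moreover have "X z q (r - m) u = 0" if "p = j"
      proof (rule singularD[OF u])
        show "deg T 2 z q (r - m) \<ge> 0" "z \<noteq> q \<or> r - m \<noteq> 0"
          using D False par[of q] Tz m jz ne that unfolding deg_def D_def
          by (cases "q = z"; auto split: if_splits; presburger?)+
      qed
      moreover have "r \<noteq> m" if "p = j" "q = z"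
        using D Tz m jz that unfolding deg_def D_def by (auto split: if_splits)
      ultimately show ?thesis
        unfolding w_def by (subst comm) (auto simp: X_simps)
    qed
  qed
  then have "singular T' 2 w"
    by (rule coarsen[OF vac']) (auto simp: deg_def D_def T'_def split: if_splits)
  then show ?thesis
    using vac' that unfolding T'_def by blast
qed

section \<open>Local nilpotency and sl2 strings\<close>

text \<open>Moving one \<open>x\<close> past \<open>y\<close> leaves \<open>y (x v)\<close>, where
  the nilpotency order of the argument has dropped, and \<open>y' v\<close>, covered by the
  assumption on \<open>y'\<close>.\<close>

lemma nilpotent_vectors_stable:
  fixes x y y' :: "'v \<Rightarrow> 'v"
  assumes xy: "\<And>v. x (y v) = y (x v) + y' v"
    and y': "\<And>v N. (x ^^ N) v = 0 \<Longrightarrow> \<exists>N. (x ^^ N) (y' v) = 0"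
    and x: "\<And>u v. x (u + v) = x u + x v" and y: "y 0 = 0"
    and v: "(x ^^ N) v = 0"
  shows "\<exists>N. (x ^^ N) (y v) = 0"
  using v
proof (induction N arbitrary: v)
  case 0
  then show ?case using y by (auto intro: exI[of _ 0])
next
  case (Suc N)
  have x0: "x 0 = 0" using x[of 0 0] by simp
  have pow_0: "(x ^^ n) 0 = 0" for n by (induction n) (simp_all add: x0)
  have pow_add: "(x ^^ n) (u + v) = (x ^^ n) u + (x ^^ n) v" for n u v
    by (induction n) (simp_all add: x)
  have mono: "(x ^^ (m + n)) u = 0" if "(x ^^ n) u = 0" for m n u
    using that by (simp add: funpow_add pow_0)
  obtain M where M: "(x ^^ M) (y (x v)) = 0"
    using Suc.IH[of "x v"] Suc.prems by (auto simp: funpow_swap1)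
  obtain M' where M': "(x ^^ M') (y' v) = 0"
    using y'[OF Suc.prems] by blast
  have "(x ^^ Suc (M' + M)) (y v) = (x ^^ (M' + M)) (y (x v) + y' v)"
    by (simp add: funpow_swap1[symmetric] xy) (simp add: funpow_swap1 xy)
  also have "\<dots> = 0"
    using mono[OF M, of M'] mono[OF M', of M] by (simp add: pow_add add.commute)
  finally show ?case by blast
qed

text \<open>The vectors on which \<open>X p q k\<close> is nilpotent form a submodule containing
  \<open>w\<close>. Up to scalars, bracketing with \<open>X p q k\<close> sends a general
  \<open>X a b l\<close> into row \<open>p\<close> and column \<open>q\<close>, those to multiples
  of some \<open>X p q\<close>, and these to 0; stability is shown in the reverse order.\<close>

lemma X_locally_nilpotent:
  assumes pq: "p \<noteq> q" "isl p = isl q" and w: "w \<in> Hom" "w \<noteq> 0" "(X p q k ^^ N) w = 0"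
  shows "locally_nilpotent (X p q k)"
proof -
  let ?x = "X p q k"
  define nil where "nil v \<longleftrightarrow> (\<exists>N. (?x ^^ N) v = 0)" for v
  have pow_0: "(?x ^^ n) 0 = 0" for n by (induction n) (simp_all add: X_simps)
  have pow_add: "(?x ^^ n) (u + v) = (?x ^^ n) u + (?x ^^ n) v" for n u v
    by (induction n) (simp_all add: X_simps)
  have pow_sc: "(?x ^^ n) (sc c u) = sc c ((?x ^^ n) u)" for n c u
    by (induction n) (simp_all add: X_simps)
  have nil_0: "nil 0"
    unfolding nil_def by (auto simp: pow_0)
  have nil_add: "nil (u + v)" if uv: "nil u" "nil v" for u v
  proof -
    obtain M N where "(?x ^^ M) u = 0" "(?x ^^ N) v = 0"
      using uv by (auto simp: nil_def)
    then have "(?x ^^ (N + M)) u = 0" "(?x ^^ (M + N)) v = 0"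
      by (simp_all add: funpow_add pow_0)
    then show ?thesis unfolding nil_def by (metis pow_add add.right_neutral add.commute)
  qed
  have nil_sc: "nil (sc c u)" if "nil u" for c u
    using that by (auto simp: nil_def pow_sc intro: exI)
  have nil_diff: "nil (u - v)" if "nil u" "nil v" for u v
    using nil_add[OF that(1) nil_sc[OF that(2), of "- 1"]] by simp
  have stable: "nil (y v)"
    if "\<And>v. ?x (y v) = y (?x v) + y' v" "\<And>v. nil v \<Longrightarrow> nil (y' v)" "y 0 = 0" "nil v" for y y' v
    using nilpotent_vectors_stable[of ?x y y'] that X_simps(1) unfolding nil_def by blast
  have comm': "?x (X a b l v) = X a b l (?x v) + ((if q = a then X p b (k + l) v else 0)
      - (if b = p then X a q (k + l) v else 0)
      + sc (if q = a \<and> b = p \<and> k + l = 0 then of_int k * supersign p else 0) v)" for a b l v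
    by (subst comm) (use pq in \<open>simp add: comm_sign_def\<close>)
  have self: "nil (X p q l v)" if "nil v" for l v
    by (rule stable[where y = "X p q l", OF comm' _ _ that]) (use pq in \<open>simp_all add: nil_0 X_simps\<close>)
  have left: "nil (X p b l v)" if "nil v" for b l v
    by (rule stable[where y = "X p b l", OF comm' _ _ that]) (use pq in \<open>simp_all add: nil_0 X_simps nil_sc[of _ "- 1", simplified] self\<close>)
  have right: "nil (X a q l v)" if "nil v" for a l v
    by (rule stable[where y = "X a q l", OF comm' _ _ that]) (cases "a = q"; use pq in \<open>simp_all add: nil_0 X_simps self\<close>)+
  have X: "nil (X a b l v)" if "nil v" for a b l v
    by (rule stable[where y = "X a b l", OF comm' _ _ that]) (simp_all add: nil_0 X_simps left right nil_add nil_diff nil_sc)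
  have "?x (d v) = d (?x v) + sc (- of_int k) (?x v)" for v
    by (simp add: d_comm)
  then have d: "nil (d v)" if "nil v" for v
    by (rule stable[where y = d, OF _ _ _ that]) (simp_all add: d_simps X nil_sc del: scale_minus_left)
  have "nil w" using w(3) by (auto simp: nil_def)
  have "nil v" for v
  proof -
    have "v \<in> Collect nil"
    proof (rule generate[OF w(1,2)])
      show "subspace (Collect nil)"
        by (auto simp: subspace_def nil_0 nil_add nil_sc)
    qed (simp_all add: X d \<open>nil w\<close>)
    then show ?thesis by simp
  qed
  then show ?thesis by (simp add: locally_nilpotent_def nil_def)
qed

text \<open>The standard sl2 computation on a vector killed by the raising operator
  \<open>X p q k\<close>; \<open>c\<close> is the value of the coroot.\<close>

lemma sl2_string:
  assumes pq: "p \<noteq> q" "isl p = isl q"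
    and u: "X p q k u = 0" "X p p 0 u = sc a u" "X q q 0 u = sc b u"
    and c: "c = a - b + of_int k * supersign p"
  shows "X p q k ((X q p (- k) ^^ Suc N) u) = sc (of_nat (Suc N) * (c - of_nat N)) ((X q p (- k) ^^ N) u)"
proof -
  let ?y = "X q p (- k)"
  have p: "X p p 0 ((?y ^^ N) u) = sc (a - of_nat N) ((?y ^^ N) u)" for N
    using pq by (induction N) (auto simp: u cartan_X X_simps scale_left_diff_distrib scale_left_distrib)
  have q: "X q q 0 ((?y ^^ N) u) = sc (b + of_nat N) ((?y ^^ N) u)" for N
    using pq by (induction N) (auto simp: u cartan_X X_simps scale_left_diff_distrib scale_left_distrib)
  show ?thesis
  proof (induction N)
    case 0
    show ?case
      using pq by (simp, subst comm) (simp add: u c comm_sign_def X_simps scale_left_diff_distrib scale_left_distrib)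
  next
    case (Suc N)
    have "X p q k (?y w) = ?y (X p q k w) + (X p p 0 w - X q q 0 w + sc (of_int k * supersign p) w)" for w
      using pq by (subst comm) (simp add: comm_sign_def)
    then have "X p q k (?y ((?y ^^ Suc N) u)) = ?y (X p q k ((?y ^^ Suc N) u))
        + sc (a - of_nat (Suc N) - (b + of_nat (Suc N)) + of_int k * supersign p) ((?y ^^ Suc N) u)"
      by (simp only: p q scale_left_distrib scale_left_diff_distrib)
    also have "\<dots> = sc (of_nat (Suc N) * (c - of_nat N)
        + (a - of_nat (Suc N) - (b + of_nat (Suc N)) + of_int k * supersign p)) ((?y ^^ Suc N) u)"
      by (simp only: Suc.IH X_simps scale_left_distrib) simp
    also have "of_nat (Suc N) * (c - of_nat N)
        + (a - of_nat (Suc N) - (b + of_nat (Suc N)) + of_int k * supersign p)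
        = of_nat (Suc (Suc N)) * (c - of_nat (Suc N))"
      by (simp add: c algebra_simps)
    finally show ?case by simp
  qed
qed

text \<open>By \<open>sl2_string\<close>, applied to the first power of the lowering operator that
  kills \<open>u\<close>, the coroot value is that exponent minus one.\<close>

lemma sl2_weight:
  assumes pq: "p \<noteq> q" "isl p = isl q"
    and u: "u \<noteq> 0" "X p q k u = 0" "X p p 0 u = sc a u" "X q q 0 u = sc b u"
    and nil: "locally_nilpotent (X q p (- k))"
  shows "a - b + of_int k * supersign p \<in> \<nat>"
proof -
  let ?y = "X q p (- k)"
  define N where "N = (LEAST N. (?y ^^ N) u = 0)"
  obtain N' where "(?y ^^ N') u = 0"
    using nil by (auto simp: locally_nilpotent_def)
  then have N: "(?y ^^ N) u = 0"
    unfolding N_def by (rule LeastI)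
  then obtain m where m: "N = Suc m"
    using u(1) by (cases N) auto
  have "(?y ^^ m) u \<noteq> 0"
    using not_less_Least[of m "\<lambda>N. (?y ^^ N) u = 0"] m by (simp add: N_def)
  then have "of_nat (Suc m) * (a - b + of_int k * supersign p - of_nat m) = 0"
    using sl2_string[OF pq u(2,3,4) refl, of m] N m by (simp add: X_simps del: of_nat_Suc)
  then have "a - b + of_int k * supersign p = of_nat m"
    by (simp del: of_nat_Suc)
  then show ?thesis by simp
qed

text \<open>The weight of the odd reflection of \<open>u\<close> in the isotropic root of \<open>X p m k\<close> also has to be
  dominant.\<close>

lemma integrable_labels:
  assumes p: "p \<noteq> q" "isl p = isl q" "isl m \<noteq> isl p"
    and u: "u \<noteq> 0" "\<And>p. X p p 0 u = sc (\<mu> p) u"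
    and sing: "X p m k u = 0" "X m q l u = 0" "X p q (k + l) u = 0"
    and nil: "locally_nilpotent (X q p (- (k + l)))"
  shows "\<mu> p - \<mu> q + of_int (k + l) * supersign p \<in> \<nat>"
    and "\<mu> p - \<mu> q + of_int (k + l) * supersign p = 0 \<Longrightarrow> \<mu> p + \<mu> m + of_int k * supersign p = 0"
proof -
  show "\<mu> p - \<mu> q + of_int (k + l) * supersign p \<in> \<nat>"
    by (rule sl2_weight[OF p(1,2) u(1) sing(3) u(2) u(2) nil])
  assume 0: "\<mu> p - \<mu> q + of_int (k + l) * supersign p = 0"
  show "\<mu> p + \<mu> m + of_int k * supersign p = 0"
  proof (rule ccontr)
    assume ne: "\<mu> p + \<mu> m + of_int k * supersign p \<noteq> 0"
    \<comment> \<open>The odd reflection of \<open>u\<close>: nonzero and still killed by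
      \<open>X p q (k + l)\<close>, but with the label lowered from 0 to -1.\<close>
    define w where "w = X m p (- k) u"
    have "p \<noteq> m" "q \<noteq> m" using p by auto
    have "X p m k w = sc (\<mu> p + \<mu> m + of_int k * supersign p) u"
      unfolding w_def
      by (subst comm) (use p \<open>p \<noteq> m\<close> in \<open>simp add: sing u comm_sign_def X_simps scale_left_distrib\<close>)
    then have "w \<noteq> 0"
      using ne u(1) by (auto simp: X_simps)
    moreover have "X p q (k + l) w = 0"
      unfolding w_def
      by (subst comm) (use p \<open>p \<noteq> m\<close> \<open>q \<noteq> m\<close> in \<open>simp add: sing X_simps comm_sign_def\<close>)
    moreover have "X p p 0 w = sc (\<mu> p - 1) w" "X q q 0 w = sc (\<mu> q) w"
      unfolding w_def using p \<open>p \<noteq> m\<close> \<open>q \<noteq> m\<close>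
      by (simp_all add: cartan_X u X_simps scale_left_diff_distrib)
    ultimately have "\<mu> p - 1 - \<mu> q + of_int (k + l) * supersign p \<in> \<nat>"
      using p(1,2) nil by (intro sl2_weight)
    moreover have "\<mu> p - 1 - \<mu> q + of_int (k + l) * supersign p =
        (\<mu> p - \<mu> q + of_int (k + l) * supersign p) - 1"
      by (simp add: algebra_simps)
    ultimately have "(- 1 :: complex) \<in> \<nat>" using 0 by (metis diff_0)
    then show False
      by (simp add: minus_one_in_Nats)
  qed
qed

section \<open>Integrability of modules with a vacuum vector\<close>

text \<open>One nonzero vector suffices for each operator: for the block of the e_i a vacuum with
  enough modes of \<open>Inl j\<close> emptied, for the block of the f_j the vector \<open>u\<close>
  itself.\<close>

lemma integrable_vacuum:
  assumes vac: "vacuum_weight z T l u" and u: "singular T 2 u" and z: "\<not> isl z"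
    and T: "\<And>a. \<not> isl a \<Longrightarrow> a \<noteq> z \<Longrightarrow> T a = - 1"
  shows "i \<noteq> j \<Longrightarrow> locally_nilpotent (X (Inl i) (Inl j) k)"
    and "i \<noteq> j \<Longrightarrow> locally_nilpotent (X (Inr i) (Inr j) 0)"
proof -
  assume ij: "i \<noteq> j"
  have "\<exists>u l. vacuum_weight z (T(Inl j := T (Inl j) - 2 * int N)) l u \<and>
      singular (T(Inl j := T (Inl j) - 2 * int N)) 2 u" for N
  proof (induction N)
    case 0
    then show ?case using vac u by auto
  next
    case (Suc N)
    then obtain u l where "vacuum_weight z (T(Inl j := T (Inl j) - 2 * int N)) l u"
      "singular (T(Inl j := T (Inl j) - 2 * int N)) 2 u" by blast
    then obtain u' where "vacuum_weight z (T(Inl j := T (Inl j) - 2 * int N, Inl j := T (Inl j) - 2 * int N - 2)) (Suc l) u'"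
      "singular (T(Inl j := T (Inl j) - 2 * int N, Inl j := T (Inl j) - 2 * int N - 2)) 2 u'"
      using z by (auto elim: move_fermion[where j = "Inl j"])
    moreover have "T(Inl j := T (Inl j) - 2 * int N, Inl j := T (Inl j) - 2 * int N - 2)
        = T(Inl j := T (Inl j) - 2 * int (Suc N))"
      by (auto simp: fun_eq_iff)
    ultimately show ?case by metis
  qed
  \<comment> \<open>So many modes are emptied that \<open>X (Inl i) (Inl j) k\<close> gets
    nonnegative degree.\<close>
  then obtain u' l' where u': "vacuum_weight z (T(Inl j := T (Inl j) - 2 * int (nat (T (Inl j) - T (Inl i) - 2 * k)))) l' u'"
      "singular (T(Inl j := T (Inl j) - 2 * int (nat (T (Inl j) - T (Inl i) - 2 * k)))) 2 u'"
    by blast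
  have "X (Inl i) (Inl j) k u' = 0"
    using ij by (intro singularD[OF u'(2)]) (auto simp: deg_def)
  then have "(X (Inl i) (Inl j) k ^^ 1) u' = 0"
    by simp
  moreover have "u' \<in> Hom" "u' \<noteq> 0"
    using u'(1) by (simp_all add: vacuum_weight_def)
  ultimately show "locally_nilpotent (X (Inl i) (Inl j) k)"
    using ij by (intro X_locally_nilpotent[where w = u' and N = 1]) simp_all
next
  assume ij: "i \<noteq> j"
  let ?y = "X (Inr i) (Inr j) 0"
  have uH: "u \<in> Hom" "u \<noteq> 0" "T z = 0" "X z z 0 u = sc (of_nat l) u"
    using vac by (auto simp: vacuum_weight_def)
  have "(?y ^^ Suc l) u = 0"
  \<comment> \<open>Only taking bosons out of \<open>z\<close> has negative degree; the
    \<open>l\<close> bosons there are used up before step \<open>Suc l\<close>.\<close>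
  proof (cases "Inr j = z")
    case False
    then have "?y u = 0"
      using ij T[of "Inr i"] T[of "Inr j"] uH by (intro singularD[OF u]; cases "Inr i = z") (simp_all add: deg_def)
    then have "(?y ^^ m) (?y u) = 0" for m
      by (induction m) (simp_all add: X_simps)
    then show ?thesis by (simp add: funpow_swap1)
  next
    case True
    then have z: "z = Inr j" and i: "T (Inr i) = - 1" "Inr i \<noteq> z"
      using ij T by auto
    have odd: "odd (T p)" if "p \<noteq> z" for p
      using vac that by (auto simp: vacuum_weight_def)
    have kill0: "X (Inr i) q k ((?y ^^ N) u) = 0" if "q \<noteq> Inr i" "X (Inr i) q k u = 0" for q k N
    proof (induction N)
      case (Suc N)
      then show ?case
        using that i z by (simp, subst comm) (auto simp: X_simps)
    qed (use that in simp)
    \<comment> \<open>A commutator with \<open>?y\<close> lowers the degree by 1. If it reaches 0,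
      the parity of \<open>T\<close> and the exempted operator rule this out for
      \<open>q = Inr i\<close>, while for \<open>p = Inr j\<close> the operator commutes with
      \<open>?y\<close> and \<open>kill0\<close> applies.\<close>
    have kill: "X p q k ((?y ^^ N) u) = 0"
      if "deg T 2 p q k \<ge> 1" "\<not> (p = z \<and> q = Inr i \<and> k = 0)" for p q k N
      using that
    proof (induction N arbitrary: p q k)
      case 0
      then show ?case
        by (auto intro!: singularD[OF u] simp: deg_def)
    next
      case (Suc N)
      have 1: "X p (Inr j) k ((?y ^^ N) u) = 0" if "q = Inr i"
      proof (cases "deg T 2 p (Inr j) k \<ge> 1")
        case True
        then show ?thesis using i z by (intro Suc.IH) auto
      next
        case False
        have "p \<noteq> z"
          using Suc.prems that uH(3) i(1) z False by (auto simp: deg_def)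
        then show ?thesis
          using odd[OF \<open>p \<noteq> z\<close>] False Suc.prems that uH(3) i z by (auto simp: deg_def) presburger
      qed
      have 2: "X (Inr i) q k ((?y ^^ N) u) = 0" if "p = Inr j"
      proof (cases "deg T 2 (Inr i) q k \<ge> 1")
        case True
        then show ?thesis using i z by (intro Suc.IH) auto
      next
        case False
        have q: "q \<noteq> Inr i"
          using False Suc.prems that i z uH(3) by (auto simp: deg_def)
        have "deg T 2 (Inr i) q k \<ge> 0"
          using Suc.prems(1) that i z uH(3) by (auto simp: deg_def)
        then have "X (Inr i) q k u = 0"
          using q by (intro singularD[OF u]) auto
        then show ?thesis
          by (rule kill0[OF q])
      qed
      have "X p q k (?y w) = sc (comm_sign p q (Inr i) (Inr j)) (?y (X p q k w))
          + (if q = Inr i then X p (Inr j) k w else 0)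
          - sc (comm_sign p q (Inr i) (Inr j)) (if p = Inr j then X (Inr i) q k w else 0)" for w
        by (subst comm) auto
      moreover have "(if q = Inr i then X p (Inr j) k ((?y ^^ N) u) else 0) = 0"
        "(if p = Inr j then X (Inr i) q k ((?y ^^ N) u) else 0) = 0"
        using 1 2 by simp_all
      ultimately show ?case
        using Suc.IH[OF Suc.prems] by (simp add: X_simps del: if_split)
    qed
    let ?w = "(?y ^^ Suc l) u"
    have "X (Inr i) (Inr i) 0 u = sc 0 u"
      using vac i by (auto simp: vacuum_weight_def)
    moreover have "X z (Inr i) 0 u = 0"
      using i uH(3) by (intro singularD[OF u]) (auto simp: deg_def)
    \<comment> \<open>The exempted operator: its coroot has the value \<open>l\<close> on
      \<open>u\<close>, so \<open>sl2_string\<close> contributes the factor \<open>l - l\<close> at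
      the power \<open>Suc l\<close>.\<close>
    ultimately have "X z (Inr i) 0 ?w = 0"
      using sl2_string[where p = z and q = "Inr i" and k = 0 and N = l and b = 0, OF _ _ _ uH(4) _ refl] i z
      by simp
    then have sing: "X p q k ?w = 0" if "deg T 2 p q k > 0" for p q k
      using kill[of p q k "Suc l"] that by (cases "p = z \<and> q = Inr i \<and> k = 0") auto
    obtain c where c: "grade T 2 u = sc c u"
      using vacuum_weight_grade[OF vac] by blast
    have grade: "grade T 2 ((?y ^^ N) u) = sc (c - of_nat N) ((?y ^^ N) u)" for N
      using i z uH(3)
      by (induction N) (auto simp: c grade_X X_simps deg_def scale_left_distrib scale_left_diff_distrib)
    have Hom: "(?y ^^ N) u \<in> Hom" for N
      by (induction N) (simp_all add: uH Hom_X)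
    show ?thesis
      by (rule no_lower_singular[OF Hom sing grade, where m = "int (Suc l)" and u = u])
        (use c uH in auto)
  qed
  then show "locally_nilpotent ?y"
    using ij uH by (intro X_locally_nilpotent[where w = u and N = "Suc l"]) simp_all
qed

end

section \<open>The supertranspose twist\<close>

text \<open>The negative supertranspose sends \<open>elem p q\<close> to
  \<open>dual_sign p q\<close> times \<open>elem q p\<close>. Its square is -1 on odd elements, so
  the sign cannot be symmetric in \<open>p\<close> and \<open>q\<close>.\<close>

definition dual_sign :: "'n + 'n \<Rightarrow> 'n + 'n \<Rightarrow> complex" where
  "dual_sign p q = (if \<not> isl p \<and> isl q then 1 else - 1)"

context level_one_rep
begin

text \<open>The twist by the automorphism $A(k) \mapsto -A^{st}(k)$, where $st$ is the supertranspose.\<close>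

lemma dual: "level_one_rep sc (\<lambda>p q k v. sc (dual_sign p q) (X q p k v)) d Hom"
proof unfold_locales
  fix p q a b :: "'n + 'n" and k l :: int and v w u :: 'v and c :: complex and W
  show "sc (dual_sign p q) (X q p k (u + v)) = sc (dual_sign p q) (X q p k u) + sc (dual_sign p q) (X q p k v)"
    "sc (dual_sign p q) (X q p k (sc c v)) = sc c (sc (dual_sign p q) (X q p k v))"
    by (simp_all add: X_simps scale_right_distrib mult.commute)
  show "d (u + v) = d u + d v" "d (sc c v) = sc c (d v)"
    by (simp_all add: d_simps)
  show "sc (dual_sign p q) (X q p k (sc (dual_sign a b) (X b a l v))) =
      sc (comm_sign p q a b) (sc (dual_sign a b) (X b a l (sc (dual_sign p q) (X q p k v))))
      + (if q = a then sc (dual_sign p b) (X b p (k + l) v) else 0)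
      - sc (comm_sign p q a b) (if b = p then sc (dual_sign a q) (X q a (k + l) v) else 0)
      + sc (if q = a \<and> b = p \<and> k + l = 0 then of_int k * supersign p else 0) v"
    unfolding X_simps
    by (subst comm, cases "isl p"; cases "isl q"; cases "isl a"; cases "isl b")
      (auto simp: dual_sign_def comm_sign_def supersign_def scale_right_distrib scale_right_diff_distrib)
  show "d (sc (dual_sign p q) (X q p k v)) =
      sc (dual_sign p q) (X q p k (d v)) + sc (of_int k) (sc (dual_sign p q) (X q p k v))"
    by (simp add: d_simps d_comm scale_right_distrib mult.commute)
  show "sc (dual_sign p q) (X q p k w) \<in> Hom" if "w \<in> Hom"
    using Hom_scale Hom_X that by blast
  show "sc c w \<in> Hom" if "w \<in> Hom"
    using that by (rule Hom_scale)
  show "u \<in> W" if "w \<in> Hom" "w \<noteq> 0" "subspace W" "w \<in> W"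
    "\<And>p q k u. u \<in> W \<Longrightarrow> sc (dual_sign p q) (X q p k u) \<in> W" "\<And>u. u \<in> W \<Longrightarrow> d u \<in> W"
  proof (rule generate[OF that(1-4) _ that(6)])
    fix p q k u assume "u \<in> W"
    \<comment> \<open>The twisted operator with exchanged indices is a sign times
      \<open>X p q k\<close>; scaling by the same sign undoes it.\<close>
    then have "sc (dual_sign q p) (sc (dual_sign q p) (X p q k u)) \<in> W"
      using that(3,5) by (blast intro: subspace_scale)
    then show "X p q k u \<in> W"
      by (simp add: dual_sign_def split: if_splits)
  qed
qed

end

subsection \<open>Modules over the affine Lie superalgebra\<close>

lemma elem_mult: "elem p q ** elem a b = (if q = a then elem p b else 0)"
proof -
  have "(\<Sum>t\<in>UNIV. (if r = p \<and> t = q then 1 else 0) * (if t = a \<and> s = b then 1 else 0))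
      = (if q = a then if r = p \<and> s = b then 1 else 0 else (0 :: complex))" for r s
  proof -
    have "(\<Sum>t\<in>UNIV. (if r = p \<and> t = q then 1 else 0) * (if t = a \<and> s = b then 1 else 0))
        = (\<Sum>t\<in>UNIV. if t = q then (if r = p \<and> q = a \<and> s = b then 1 else (0 :: complex)) else 0)"
      by (intro sum.cong) auto
    then show ?thesis by simp
  qed
  then show ?thesis
    by (auto simp: matrix_matrix_mult_def elem_def vec_eq_iff)
qed

lemma Str_elem: "Str (elem p q) = (if p = q then supersign p else 0)"
proof (cases "p = q")
  case True
  have "Str (elem p p) = supersign p"
    by (cases p) (simp_all add: Str_def elem_def supersign_def)
  then show ?thesis using True by simp
next
  case False
  then have "elem p q $ r $ r = 0" for r
    by (auto simp: elem_def)
  then show ?thesis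
    using False by (simp add: Str_def)
qed

lemma gl_component_elem: "gl_component (isl p \<noteq> isl q) (elem p q) = elem p q"
  by (auto simp: gl_component_def elem_def vec_eq_iff)

lemma loop_elem_part: "loop (elem p q) k \<in> aff_part (isl p \<noteq> isl q)"
  using gl_component_elem[of p q]
  by (auto simp: aff_part_def loop_def lookup_single when_def)

lemma loop_diff: "loop (A - s *\<^sub>R B) k = loop A k - ascale (of_real s) (loop B k)"
  by (auto simp: loop_def ascale_def lookup_minus lookup_single when_def mscale_def vec_eq_iff
      scaleR_conv_of_real[where 'a = complex] zero_prod_def intro!: poly_mapping_eqI)

lemma loop_0: "loop 0 k = 0"
  by (simp add: loop_def zero_prod_def)

lemma Str_0: "Str 0 = 0"
  by (simp add: Str_def)

lemma aff_bracket_elem: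
  "aff_bracket (loop (elem p q) k) (loop (elem a b) l) =
     (if q = a then loop (elem p b) (k + l) else 0)
     - ascale (comm_sign p q a b) (if b = p then loop (elem a q) (k + l) else 0)
     + ascale (if q = a \<and> b = p \<and> k + l = 0 then of_int k * supersign p else 0) central"
proof -
  have "gl_bracket (elem p q) (elem a b) =
      elem p q ** elem a b - super_sign (isl p \<noteq> isl q) (isl a \<noteq> isl b) *\<^sub>R (elem a b ** elem p q)"
    by (rule gl_bracket_homogeneous) (rule gl_component_elem)+
  moreover have "complex_of_real (super_sign (isl p \<noteq> isl q) (isl a \<noteq> isl b)) = comm_sign p q a b"
    by (simp add: super_sign_def comm_sign_def)
  ultimately show ?thesis
    unfolding aff_bracket_loop_loop elem_mult
    by (auto simp: loop_diff loop_0 Str_elem Str_0)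
qed

text \<open>Lets closure under the whole algebra be checked on matrix units, \<open>central\<close>
  and \<open>deriv_d\<close>; see \<open>act_closed\<close>.\<close>

lemma aff_decomposition:
  "(f, c, e) = (\<Sum>k\<in>Poly_Mapping.keys f. \<Sum>p\<in>UNIV. \<Sum>q\<in>UNIV.
      ascale (Poly_Mapping.lookup f k $ p $ q) (loop (elem p q) k))
    + ascale c central + ascale e deriv_d"
proof -
  have elem: "A = (\<Sum>p\<in>UNIV. \<Sum>q\<in>UNIV. mscale (A $ p $ q) (elem p q))" for A :: "'a gl"
  proof -
    have "A $ r $ s = (\<Sum>p\<in>UNIV. \<Sum>q\<in>UNIV. A $ p $ q * (if r = p \<and> s = q then 1 else 0))" for r s
    proof -
      have "(\<Sum>p\<in>UNIV. \<Sum>q\<in>UNIV. A $ p $ q * (if r = p \<and> s = q then 1 else 0))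
          = (\<Sum>p\<in>UNIV. \<Sum>q\<in>UNIV. if p = r then if q = s then A $ p $ q else 0 else 0)"
        by (intro sum.cong refl) auto
      also have "\<dots> = (\<Sum>p\<in>UNIV. if p = r then \<Sum>q\<in>UNIV. if q = s then A $ p $ q else 0 else 0)"
        by (intro sum.cong refl) simp
      finally show ?thesis by simp
    qed
    then show ?thesis
      unfolding vec_eq_iff sum_component mscale_def elem_def vec_lambda_beta by blast
  qed
  have loop_sum: "(\<Sum>i\<in>S. ascale (g i) (loop (h i) k)) = loop (\<Sum>i\<in>S. mscale (g i) (h i)) k"
    for S g k and h :: "'b \<Rightarrow> 'a gl"
  proof (induction S rule: infinite_finite_induct)
    case (insert i S)
    then show ?case
      by (simp add: loop_def ascale_def single_add)
  qed (simp_all add: loop_0)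
  have loop_sum': "(\<Sum>i\<in>S. loop (h i) k) = loop (\<Sum>i\<in>S. h i) k" for S k and h :: "'b \<Rightarrow> 'a gl"
    by (induction S rule: infinite_finite_induct) (simp_all add: loop_0, simp add: loop_def single_add)
  have "(\<Sum>k\<in>Poly_Mapping.keys f. \<Sum>p\<in>UNIV. \<Sum>q\<in>UNIV.
      ascale (Poly_Mapping.lookup f k $ p $ q) (loop (elem p q) k))
    = (\<Sum>k\<in>Poly_Mapping.keys f. loop (Poly_Mapping.lookup f k) k)"
    by (simp only: loop_sum loop_sum' elem[symmetric])
  also have "\<dots> = (\<Sum>k\<in>Poly_Mapping.keys f. Poly_Mapping.single k (Poly_Mapping.lookup f k), 0, 0)"
    by (simp add: loop_def sum_prod)
  also have "(\<Sum>k\<in>Poly_Mapping.keys f. Poly_Mapping.single k (Poly_Mapping.lookup f k)) = f"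
    by (rule poly_mapping_eqI) (simp add: lookup_sum lookup_single when_def in_keys_iff)
  finally show ?thesis
    by (simp add: ascale_def central_def deriv_d_def)
qed

section \<open>From modules to abstract level 1 representations\<close>

locale aff_rep =
  fixes sc :: "complex \<Rightarrow> 'v::ab_group_add \<Rightarrow> 'v" and P :: "bool \<Rightarrow> 'v set"
    and \<rho> :: "('n::finite) aff \<Rightarrow> 'v \<Rightarrow> 'v"
  assumes mod: "aff_module sc P \<rho>"
begin

sublocale vector_space sc
  using mod by (simp add: aff_module_def)

lemma act_linear: "Vector_Spaces.linear sc sc (\<rho> x)"
  using mod by (simp add: aff_module_def del: split_paired_All)

lemma act_simps:
  "\<rho> x (u + v) = \<rho> x u + \<rho> x v" "\<rho> x (u - v) = \<rho> x u - \<rho> x v" "\<rho> x (sc c u) = sc c (\<rho> x u)"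
  "\<rho> x 0 = 0" "\<rho> (x + y) v = \<rho> x v + \<rho> y v" "\<rho> (x - y) v = \<rho> x v - \<rho> y v"
  "\<rho> (ascale c x) v = sc c (\<rho> x v)" "\<rho> 0 v = 0" "\<rho> (sum g S) v = (\<Sum>s\<in>S. \<rho> (g s) v)"
proof -
  interpret x: Vector_Spaces.linear sc sc "\<rho> x" by (rule act_linear)
  interpret v: Vector_Spaces.linear ascale sc "\<lambda>x. \<rho> x v"
    using mod by (simp add: aff_module_def del: split_paired_All)
  show "\<rho> x (u + v) = \<rho> x u + \<rho> x v" "\<rho> x (u - v) = \<rho> x u - \<rho> x v" "\<rho> x (sc c u) = sc c (\<rho> x u)"
    "\<rho> x 0 = 0" "\<rho> (x + y) v = \<rho> x v + \<rho> y v" "\<rho> (x - y) v = \<rho> x v - \<rho> y v"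
    "\<rho> (ascale c x) v = sc c (\<rho> x v)" "\<rho> 0 v = 0" "\<rho> (sum g S) v = (\<Sum>s\<in>S. \<rho> (g s) v)"
    by (simp_all add: x.add x.diff x.scale x.zero v.add v.diff v.scale v.zero v.sum)
qed

lemma act_part: "x \<in> aff_part a \<Longrightarrow> v \<in> P b \<Longrightarrow> \<rho> x v \<in> P (a \<noteq> b)"
  using mod by (simp add: aff_module_def del: split_paired_All)

lemma act_bracket:
  "x \<in> aff_part a \<Longrightarrow> y \<in> aff_part b \<Longrightarrow>
     \<rho> (aff_bracket x y) v = \<rho> x (\<rho> y v) - sc (of_real (super_sign a b)) (\<rho> y (\<rho> x v))"
  using mod by (simp add: aff_module_def del: split_paired_All)

lemma subspace_P: "subspace (P a)"
  using mod by (simp add: aff_module_def del: split_paired_All)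

lemma P_disjoint: "v \<in> P False \<Longrightarrow> v \<in> P True \<Longrightarrow> v = 0"
  using mod IntI by (auto simp: aff_module_def simp del: split_paired_All)

lemma P_decompose: "\<exists>v0\<in>P False. \<exists>v1\<in>P True. v = v0 + v1"
  using mod by (simp add: aff_module_def del: split_paired_All)

lemma even_elements: "central \<in> aff_part False" "deriv_d \<in> aff_part False"
  by (simp_all add: aff_part_def central_def deriv_d_def)

lemma act_closed:
  assumes W: "subspace W"
    and "\<And>p q k. \<rho> (loop (elem p q) k) u \<in> W" "\<rho> central u \<in> W" "\<rho> deriv_d u \<in> W"
  shows "\<rho> x u \<in> W"
proof -
  obtain f c e where x: "x = (f, c, e)" by (cases x) auto
  show ?thesis
    unfolding x aff_decomposition[of f c e] act_simps
    by (intro subspace_add[OF W] subspace_sum[OF W] subspace_scale[OF W] assms)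
qed

lemma act_elem_comm:
  "\<rho> (loop (elem p q) k) (\<rho> (loop (elem a b) l) v) =
      sc (comm_sign p q a b) (\<rho> (loop (elem a b) l) (\<rho> (loop (elem p q) k) v))
      + (if q = a then \<rho> (loop (elem p b) (k + l)) v else 0)
      - sc (comm_sign p q a b) (if b = p then \<rho> (loop (elem a q) (k + l)) v else 0)
      + sc (if q = a \<and> b = p \<and> k + l = 0 then of_int k * supersign p else 0) (\<rho> central v)"
proof -
  have "complex_of_real (super_sign (isl p \<noteq> isl q) (isl a \<noteq> isl b)) = comm_sign p q a b"
    by (simp add: super_sign_def comm_sign_def)
  then have 1: "\<rho> (loop (elem p q) k) (\<rho> (loop (elem a b) l) v) =
      \<rho> (aff_bracket (loop (elem p q) k) (loop (elem a b) l)) v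
      + sc (comm_sign p q a b) (\<rho> (loop (elem a b) l) (\<rho> (loop (elem p q) k) v))"
    by (simp add: act_bracket[OF loop_elem_part loop_elem_part])
  have 2: "\<rho> (aff_bracket (loop (elem p q) k) (loop (elem a b) l)) v =
      (if q = a then \<rho> (loop (elem p b) (k + l)) v else 0)
      - sc (comm_sign p q a b) (if b = p then \<rho> (loop (elem a q) (k + l)) v else 0)
      + sc (if q = a \<and> b = p \<and> k + l = 0 then of_int k * supersign p else 0) (\<rho> central v)"
    unfolding aff_bracket_elem by (simp add: act_simps)
  have "x = s + y - z + t" if "x = r + s" "r = y - z + t" for x r s y z t :: 'v
    using that by simp
  from this[OF 1 2] show ?thesis .
qed

lemma act_central_comm:
  "\<rho> central (\<rho> x v) = \<rho> x (\<rho> central v)" if "x \<in> aff_part a"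
  using act_bracket[OF even_elements(1) that]
  by (simp add: aff_bracket_central act_simps super_sign_def)

lemma act_d_comm:
  "\<rho> deriv_d (\<rho> (loop (elem p q) k) v) =
     \<rho> (loop (elem p q) k) (\<rho> deriv_d v) + sc (of_int k) (\<rho> (loop (elem p q) k) v)"
  using act_bracket[OF even_elements(2) loop_elem_part, of p q k v]
  by (simp add: aff_bracket_d_loop act_simps super_sign_def algebra_simps)

end

text \<open>The vectors fixed by \<open>central\<close> form a graded submodule containing the
  highest weight vector, so \<open>central\<close> acts as the identity. It then remains to derive
  \<open>generate\<close> from irreducibility, which concerns graded submodules only.\<close>

lemma is_L_level_one_rep:
  assumes L: "is_L sc P \<rho> \<Lambda>" and level: "level \<Lambda> = 1"
  shows "level_one_rep sc (\<lambda>p q k. \<rho> (loop (elem p q) k)) (\<rho> deriv_d) (P False \<union> P True)"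
proof -
  have irr: "irreducible_module sc P \<rho>"
    using L by (simp add: is_L_def)
  interpret aff_rep sc P \<rho>
    using irr by unfold_locales (simp add: irreducible_module_def)
  have "central \<in> aff_cartan"
    by (auto simp: aff_cartan_def central_def intro!: exI[of _ 0])
  then obtain v where v: "v \<noteq> 0" "\<rho> central v = v"
    using L level unfolding is_L_def highest_weight_vector_def level_def by fastforce
  have d_part: "\<rho> deriv_d w \<in> P a" if "w \<in> P a" for w a
    using act_part[OF even_elements(2) that] by simp
  have C_part: "\<rho> central w \<in> P a" if "w \<in> P a" for w a
    using act_part[OF even_elements(1) that] by simp
  have "graded_submodule sc P \<rho> {v. \<rho> central v = v}"
    unfolding graded_submodule_def
  proof (intro conjI allI ballI)
    show Z: "subspace {v. \<rho> central v = v}"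
      by (rule subspaceI) (simp_all add: act_simps(1,3,4))
    fix w assume w: "w \<in> {v. \<rho> central v = v}"
    show "\<rho> x w \<in> {v. \<rho> central v = v}" for x
      by (rule act_closed[OF Z]) (use w in \<open>auto simp: act_central_comm[OF loop_elem_part] act_central_comm[OF even_elements(2)]\<close>)
    obtain w0 w1 where *: "w0 \<in> P False" "w1 \<in> P True" "w = w0 + w1"
      using P_decompose by blast
    then have eq: "\<rho> central w0 - w0 = w1 - \<rho> central w1"
      using w by (simp add: act_simps algebra_simps)
    \<comment> \<open>The difference is even as written and odd as
      \<open>w1 - \<rho> central w1\<close>, hence 0.\<close>
    have "\<rho> central w0 - w0 \<in> P False" "\<rho> central w0 - w0 \<in> P True"
      using * by (simp add: subspace_diff[OF subspace_P] C_part)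
        (use * in \<open>simp add: eq subspace_diff[OF subspace_P] C_part\<close>)
    then have "\<rho> central w0 - w0 = 0"
      by (rule P_disjoint)
    then show "\<exists>w0\<in>{v. \<rho> central v = v} \<inter> P False. \<exists>w1\<in>{v. \<rho> central v = v} \<inter> P True. w = w0 + w1"
      using eq * by (intro bexI[of _ w0] bexI[of _ w1]) auto
  qed
  then have "{v. \<rho> central v = v} = UNIV"
    using irr v unfolding irreducible_module_def by blast
  then have central: "\<rho> central u = u" for u
    by blast
  show ?thesis
  proof unfold_locales
    fix p q a b :: "'b + 'b" and k l :: int and v w u :: 'a and c :: complex and W
    show "\<rho> (loop (elem p q) k) (\<rho> (loop (elem a b) l) v) =
      sc (comm_sign p q a b) (\<rho> (loop (elem a b) l) (\<rho> (loop (elem p q) k) v))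
      + (if q = a then \<rho> (loop (elem p b) (k + l)) v else 0)
      - sc (comm_sign p q a b) (if b = p then \<rho> (loop (elem a q) (k + l)) v else 0)
      + sc (if q = a \<and> b = p \<and> k + l = 0 then of_int k * supersign p else 0) v"
      by (subst act_elem_comm) (simp add: central)
    show "\<rho> (loop (elem p q) k) w \<in> P False \<union> P True" if "w \<in> P False \<union> P True"
      using that act_part[OF loop_elem_part[of p q k], of w] by (metis Un_iff)
    show "sc c w \<in> P False \<union> P True" if "w \<in> P False \<union> P True"
      using that subspace_scale[OF subspace_P] by blast
    show "u \<in> W" if w: "w \<in> P False \<union> P True" "w \<noteq> 0" and W: "subspace W" "w \<in> W"
      and X: "\<And>p q k u. u \<in> W \<Longrightarrow> \<rho> (loop (elem p q) k) u \<in> W" and d: "\<And>u. u \<in> W \<Longrightarrow> \<rho> deriv_d u \<in> W"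
    proof -
      \<comment> \<open>\<open>W\<close> need not be graded; the sum of its homogeneous parts is,
        and it contains the homogeneous vector \<open>w\<close>.\<close>
      define W' where "W' = {w0 + w1 | w0 w1. w0 \<in> W \<inter> P False \<and> w1 \<in> W \<inter> P True}"
      have sub: "subspace (W \<inter> P a)" for a
        using W(1) subspace_P by (rule subspace_inter)
      have W'_part: "y \<in> W'" if "y \<in> W \<inter> P a" for y a
      proof (cases a)
        case True
        then show ?thesis
          using that subspace_0[OF sub[of False]] unfolding W'_def mem_Collect_eq
          by (intro exI[of _ 0] exI[of _ y]) simp
      next
        case False
        then show ?thesis
          using that subspace_0[OF sub[of True]] unfolding W'_def mem_Collect_eq
          by (intro exI[of _ y] exI[of _ 0]) simp
      qed
      have W': "subspace W'"
        unfolding W'_def using subspace_sums[OF sub[of False] sub[of True]] by simp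
      have "graded_submodule sc P \<rho> W'"
        unfolding graded_submodule_def
      proof (intro conjI allI ballI W')
        fix y assume "y \<in> W'"
        then obtain w0 w1 where *: "w0 \<in> W \<inter> P False" "w1 \<in> W \<inter> P True" "y = w0 + w1"
          by (auto simp: W'_def)
        then show "\<exists>w0\<in>W' \<inter> P False. \<exists>w1\<in>W' \<inter> P True. y = w0 + w1"
          using W'_part by blast
        have "\<rho> x z \<in> W'" if z: "z \<in> W \<inter> P a" for z x a
        proof (rule act_closed[OF W'])
          show "\<rho> (loop (elem p q) k) z \<in> W'" for p q k
            using z X act_part[OF loop_elem_part[of p q k], of z a] by (intro W'_part) auto
          show "\<rho> central z \<in> W'" "\<rho> deriv_d z \<in> W'"
            using z d d_part by (auto simp: central intro!: W'_part)
        qed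
        then show "\<rho> x y \<in> W'" for x
          unfolding *(3) act_simps(1) using *(1,2) by (intro subspace_add[OF W']) blast+
      qed
      moreover have "w \<in> W'"
        using w W W'_part by blast
      ultimately have "W' = UNIV"
        using irr w(2) unfolding irreducible_module_def by blast
      then have "u \<in> W'" by simp
      then show "u \<in> W"
        using W(1) by (auto simp: W'_def intro: subspace_add)
    qed
  qed (simp_all add: act_simps act_d_comm)
qed

subsection \<open>Integrability of the listed modules\<close>

text \<open>Removes the sign that the dual twist puts on even matrix units.\<close>

lemma (in vector_space) locally_nilpotent_neg:
  assumes "Vector_Spaces.linear scale scale f" "locally_nilpotent (\<lambda>v. scale (- 1) (f v))"
  shows "locally_nilpotent f"
proof -
  interpret f: Vector_Spaces.linear scale scale f by (rule assms)
  have "((\<lambda>v. scale (- 1) (f v)) ^^ N) v = scale ((- 1) ^ N) ((f ^^ N) v)" for N v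
    by (induction N) (simp_all add: f.scale f.neg)
  then show ?thesis
    using assms(2) by (simp add: locally_nilpotent_def)
qed

section \<open>The non-standard order as a grading\<close>

text \<open>The place of a basis vector in f_1 < e_1 < ... < f_n < e_n, counted from 0.\<close>

definition position :: "'n::{finite,linorder} + 'n \<Rightarrow> int" where
  "position = case_sum (\<lambda>i. 2 * int (card {..<i}) + 1) (\<lambda>i. 2 * int (card {..<i}))"

lemma card_lessThan_less_iff: "card {..<i} < card {..<j} \<longleftrightarrow> i < (j :: 'n::{finite,linorder})"
proof
  show "i < j" if "card {..<i} < card {..<j}"
  proof (rule ccontr)
    assume "\<not> i < j"
    then have "card {..<j} \<le> card {..<i}" by (intro card_mono) auto
    then show False using that by simp
  qed
  show "card {..<i} < card {..<j}" if "i < j"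
    using that by (intro psubset_card_mono) auto
qed

lemma nonstd_le_position: "nonstd_le p q \<longleftrightarrow> position p \<le> position q"
proof -
  have le: "i \<le> j \<longleftrightarrow> card {..<i} \<le> card {..<j}" for i j :: 'a
    using card_lessThan_less_iff[of j i] by (simp add: not_less[symmetric])
  show ?thesis
    by (cases p; cases q) (auto simp: position_def le card_lessThan_less_iff[symmetric])
qed

text \<open>Positions lie between 0 and 2n - 1, so with period 2n every root vector of nonnegative
  degree lies in the Borel subalgebra.\<close>

lemma position_shift_nonneg:
  fixes p q :: "'n::{finite,linorder} + 'n"
  assumes "position q - position p + 2 * int CARD('n) * k \<ge> 0"
  shows "k > 0 \<or> k = 0 \<and> nonstd_le p q"
proof (cases "k < 0")
  case True
  have "card {..<i} < CARD('n)" for i :: 'n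
    by (intro psubset_card_mono) auto
  then have "0 \<le> position r" "position r < 2 * int CARD('n)" for r :: "'n + 'n"
    unfolding position_def by (cases r; simp; smt (verit) of_nat_less_iff)+
  from this(1)[of p] this(2)[of q] have "position q - position p < 2 * int CARD('n)"
    by simp
  moreover have "2 * int CARD('n) * k \<le> 2 * int CARD('n) * (- 1)"
    using True by (intro mult_left_mono) auto
  ultimately show ?thesis using assms by simp
next
  case False
  then show ?thesis using assms by (cases "k = 0") (auto simp: nonstd_le_position)
qed

lemma loop_elem_nilradical:
  assumes "k > 0 \<or> k = 0 \<and> nonstd_le p q" "p \<noteq> q \<or> k \<noteq> 0"
  shows "loop (elem p q) k \<in> aff_nilradical nonstd_borel"
  using assms by (auto simp: aff_nilradical_def aff_borel_def nonstd_borel_def loop_def elem_def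
      lookup_single when_def)

lemma cartan_elements:
  "loop (elem p p) 0 \<in> aff_cartan" "central \<in> aff_cartan" "deriv_d \<in> aff_cartan"
  by (auto simp: aff_cartan_def loop_def elem_def intro!: exI[of _ "elem p p"])
    (auto simp: aff_cartan_def central_def deriv_d_def intro!: exI[of _ 0])

lemma weights_elem:
  "eps i (loop (elem p p) 0) = (if p = Inl i then 1 else 0)"
  "delta i (loop (elem p p) 0) = (if p = Inr i then 1 else 0)"
  "Lambda0 (loop A k) = 0"
  by (auto simp: eps_def delta_def Lambda0_def loop_def elem_def)

lemma level_listed:
  assumes "\<Lambda> \<in> listed_weights"
  shows "level \<Lambda> = 1"
  using assms by (auto simp: listed_weights_def level_def eps_def delta_def Lambda0_def central_def)

lemma nonstd_le_Min: "nonstd_le p (Inr (Min UNIV)) \<longleftrightarrow> p = Inr (Min (UNIV :: 'n::{finite,linorder} set))"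
proof (cases p)
  case (Inl i)
  have "Min UNIV \<le> i" by (rule Min_le) auto
  then have "\<not> i < Min UNIV" by (rule leD)
  then show ?thesis using Inl by simp
next
  case (Inr i)
  have "Min UNIV \<le> i" by (rule Min_le) auto
  then have "i \<le> Min UNIV \<longleftrightarrow> i = Min UNIV" by (metis antisym order_refl)
  then show ?thesis unfolding Inr nonstd_le.simps sum.inject .
qed

lemma nonstd_le_Max:
  fixes p :: "'n::{finite,linorder} + 'n"
  shows "nonstd_le (Inl (Max UNIV)) p \<longleftrightarrow> p = Inl (Max UNIV)"
    and "nonstd_le (Inr (Max UNIV)) p \<longleftrightarrow> p = Inl (Max UNIV) \<or> p = Inr (Max UNIV)"
proof -
  have "i \<le> Max UNIV" for i :: 'n by (rule Max_ge) auto
  then show "nonstd_le (Inl (Max UNIV)) p \<longleftrightarrow> p = Inl (Max UNIV)"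
    "nonstd_le (Inr (Max UNIV)) p \<longleftrightarrow> p = Inl (Max UNIV) \<or> p = Inr (Max UNIV)"
    by (cases p; auto simp: not_less intro: antisym)+
qed

text \<open>The grading by position makes the highest weight vector singular, and
  \<open>coarsen\<close> gives it the relations of a vacuum; for the second family this happens in
  the dual module.\<close>

lemma listed_integrable:
  fixes \<rho> :: "('n::{finite,linorder}) aff \<Rightarrow> 'v::ab_group_add \<Rightarrow> 'v"
  assumes \<Lambda>: "\<Lambda> \<in> listed_weights" and L: "is_L sc P \<rho> \<Lambda>"
  shows "integrable_module \<rho>"
proof -
  define X where "X p q k = \<rho> (loop (elem p q) k)" for p q k
  interpret level_one_rep sc X "\<rho> deriv_d" "P False \<union> P True"
    unfolding X_def by (rule is_L_level_one_rep[OF L level_listed[OF \<Lambda>]])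
  obtain v where v: "v \<in> P False \<union> P True" "highest_weight_vector sc \<rho> nonstd_borel \<Lambda> v"
    using L by (auto simp: is_L_def)
  then have v0: "v \<noteq> 0" and wt: "X p p 0 v = sc (\<Lambda> (loop (elem p p) 0)) v"
    and wt_d: "\<rho> deriv_d v = sc (\<Lambda> deriv_d) v" for p
    using cartan_elements by (auto simp: highest_weight_vector_def X_def)
  have kill: "X p q k v = 0" if "k > 0 \<or> k = 0 \<and> nonstd_le p q" "p \<noteq> q \<or> k \<noteq> 0" for p q k
    using v(2) loop_elem_nilradical[OF that] by (auto simp: highest_weight_vector_def X_def)
  let ?N = "2 * int CARD('n)"
  consider (pos) l :: int where "l \<ge> 0" "\<Lambda> = (\<lambda>h. of_int l * delta (Min UNIV) h + Lambda0 h)"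
    | (neg) l :: int where "l < 0"
      "\<Lambda> = (\<lambda>h. of_int (l + 1) * delta (Max UNIV) h - eps (Max UNIV) h + Lambda0 h)"
    using \<Lambda> by (auto simp: listed_weights_def)
  then show ?thesis
  proof cases
    case pos
    let ?z = "Inr (Min UNIV) :: 'n + 'n"
    \<comment> \<open>Exactly the e_i t^k with \<open>k > 0\<close> are filled, and \<open>l\<close>
      bosons sit in f_1.\<close>
    define T where "T p = (if p = ?z then 0 else - 1 :: int)" for p
    have vac: "vacuum_weight ?z T (nat l) v"
      unfolding vacuum_weight_def using v(1) v0 pos wt_d
      by (auto simp: T_def wt weights_elem)
    have "singular (\<lambda>p. - position p) ?N v"
      unfolding singular_def deg_def
      by (intro allI impI kill) (auto intro!: position_shift_nonneg)
    then have "singular T 2 v"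
    proof (rule coarsen[OF vac])
      fix p q :: "'n + 'n" and k assume "deg (\<lambda>p. - position p) ?N p q k > 0"
      then have "k > 0 \<or> k = 0 \<and> nonstd_le p q"
        by (intro position_shift_nonneg) (simp add: deg_def)
      then show "deg T 2 p q k \<ge> 0"
        by (auto simp: deg_def T_def nonstd_le_Min)
    qed
    from integrable_vacuum[OF vac this] show ?thesis
      by (auto simp: integrable_module_def X_def T_def)
  next
    case neg
    let ?z = "Inr (Max UNIV) :: 'n + 'n"
    interpret dual: level_one_rep sc "\<lambda>p q k v. sc (dual_sign p q) (X q p k v)" "\<rho> deriv_d"
      "P False \<union> P True"
      by (rule dual)
    \<comment> \<open>Now e_n t^0 is filled as well and the bosons sit in f_n: the dual weight is 1
      on \<open>Inl (Max UNIV)\<close> and \<open>- (l + 1)\<close> on \<open>?z\<close>.\<close>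
    define T where "T p = (if p = ?z then 0 else if p = Inl (Max UNIV) then 1 else - 1 :: int)" for p
    have l: "complex_of_nat (nat (- (l + 1))) = - (of_int l + 1)"
      using neg(1) by (simp add: of_nat_nat)
    have vac: "dual.vacuum_weight ?z T (nat (- (l + 1))) v"
      unfolding dual.vacuum_weight_def l using v(1) v0 wt_d
      by (auto simp: T_def wt weights_elem dual_sign_def neg(2) supersign_def)
    \<comment> \<open>The twist exchanges \<open>p\<close> and \<open>q\<close>, which reverses the
      sign of \<open>position\<close>.\<close>
    have "dual.singular position ?N v"
      unfolding dual.singular_def deg_def
      by (auto simp: kill dest: position_shift_nonneg)
    then have "dual.singular T 2 v"
    proof (rule dual.coarsen[OF vac])
      fix p q :: "'n + 'n" and k assume "deg position ?N p q k > 0"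
      then have "k > 0 \<or> k = 0 \<and> nonstd_le q p"
        by (intro position_shift_nonneg) (simp add: deg_def)
      then show "deg T 2 p q k \<ge> 0"
        by (auto simp: deg_def T_def nonstd_le_Max)
    qed
    moreover have "T a = - 1" if "\<not> isl a" "a \<noteq> ?z" for a
      using that by (auto simp: T_def)
    ultimately have
      "i \<noteq> j \<Longrightarrow> locally_nilpotent (\<lambda>v. sc (- 1) (X (Inl j) (Inl i) k v))"
      "i \<noteq> j \<Longrightarrow> locally_nilpotent (\<lambda>v. sc (- 1) (X (Inr j) (Inr i) 0 v))" for i j k
      using dual.integrable_vacuum[OF vac, of i j] by (simp_all add: dual_sign_def)
    then have "i \<noteq> j \<Longrightarrow> locally_nilpotent (X (Inl i) (Inl j) k)"
      "i \<noteq> j \<Longrightarrow> locally_nilpotent (X (Inr i) (Inr j) 0)" for i j k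
      using locally_nilpotent_neg[OF X_linear] by metis+
    then show ?thesis
      by (auto simp: integrable_module_def X_def)
  qed
qed

subsection \<open>Classification\<close>

lemma Str_eq_sum: "Str A = (\<Sum>p\<in>UNIV. supersign p * A $ p $ p)"
  unfolding UNIV_Plus_UNIV[symmetric]
  by (subst sum.Plus) (simp_all add: Str_def supersign_def sum_negf)

text \<open>The two supertraces agree entry by entry: a product of the entry (p, q) of
  \<open>A\<close> and the entry (q, p) of \<open>B\<close> can be nonzero only if the parities
  match, and then the supersigns of \<open>p\<close> and \<open>q\<close> differ by
  \<open>super_sign a b\<close>.\<close>

lemma Str_gl_bracket:
  assumes A: "gl_component a A = A" and B: "gl_component b B = B"
  shows "Str (gl_bracket A B) = 0"
proof -
  have zero: "C $ p $ q = 0" if "gl_component c C = C" "(isl p \<noteq> isl q) \<noteq> c" for C :: "'a gl" and c p q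
    by (subst that(1)[symmetric]) (use that(2) in \<open>simp add: gl_component_def\<close>)
  have "Str (A ** B) = (\<Sum>p\<in>UNIV. \<Sum>q\<in>UNIV. supersign p * (A $ p $ q * B $ q $ p))"
    by (simp add: Str_eq_sum matrix_matrix_mult_def sum_distrib_left)
  also have "\<dots> = (\<Sum>q\<in>UNIV. \<Sum>p\<in>UNIV. supersign p * (A $ p $ q * B $ q $ p))"
    by (rule sum.swap)
  also have "\<dots> = (\<Sum>q\<in>UNIV. \<Sum>p\<in>UNIV. of_real (super_sign a b) * (supersign q * (B $ q $ p * A $ p $ q)))"
  proof (intro sum.cong refl)
    fix p q
    show "supersign p * (A $ p $ q * B $ q $ p) = of_real (super_sign a b) * (supersign q * (B $ q $ p * A $ p $ q))"
    proof (cases "(isl p \<noteq> isl q) = a \<and> (isl q \<noteq> isl p) = b")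
      case True
      then have "supersign p = of_real (super_sign a b) * supersign q"
        by (cases "isl p"; cases "isl q") (auto simp: supersign_def super_sign_def)
      then show ?thesis by (simp only: mult_ac)
    next
      case False
      then have "A $ p $ q = 0 \<or> B $ q $ p = 0"
        using zero[OF A, of p q] zero[OF B, of q p] by blast
      then show ?thesis by auto
    qed
  qed
  also have "\<dots> = of_real (super_sign a b) * Str (B ** A)"
    by (simp add: Str_eq_sum matrix_matrix_mult_def sum_distrib_left)
  finally have "Str (A ** B) = of_real (super_sign a b) * Str (B ** A)" .
  moreover have "Str (A ** B - super_sign a b *\<^sub>R (B ** A)) =
      Str (A ** B) - of_real (super_sign a b) * Str (B ** A)"
    by (simp add: Str_eq_sum sum_subtractf sum_distrib_left algebra_simps scaleR_conv_of_real[where 'a = complex])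
  ultimately show ?thesis
    by (simp add: gl_bracket_homogeneous[OF A B])
qed

text \<open>The characters used for normalisation: \<open>s\<close> shifts the weight along the
  supertrace, \<open>u\<close> shifts the eigenvalue of d.\<close>

definition str_character :: "complex \<Rightarrow> complex \<Rightarrow> ('n::finite) aff \<Rightarrow> complex" where
  "str_character s u = (\<lambda>(f, c, e). s * Str (Poly_Mapping.lookup f 0) + u * e)"

lemma Str_add: "Str (A + B) = Str A + Str B"
  by (simp add: Str_eq_sum sum.distrib algebra_simps)

lemma Str_diff: "Str (A - B) = Str A - Str B"
  by (simp add: Str_eq_sum sum_subtractf algebra_simps)

lemma Str_mscale: "Str (mscale c A) = c * Str A"
  by (simp add: Str_eq_sum sum_distrib_left mscale_def algebra_simps)

lemma Str_sum: "Str (sum g S) = (\<Sum>i\<in>S. Str (g i))"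
  by (induction S rule: infinite_finite_induct) (simp_all add: Str_0 Str_add)

lemma lookup_euler_0: "Poly_Mapping.lookup (euler f) 0 = 0"
  by (auto simp: euler_def lookup_sum lookup_single when_def intro!: sum.neutral)

lemma str_character_bracket:
  assumes x: "x \<in> aff_part a" and y: "y \<in> aff_part b"
  shows "str_character s u (aff_bracket x y) = 0"
proof -
  obtain f c e g c' e' where xy: "x = (f, c, e)" "y = (g, c', e')"
    by (cases x, cases y) auto
  have "Str (gl_bracket (Poly_Mapping.lookup f k) (Poly_Mapping.lookup g l)) = 0" for k l
    using x y unfolding xy aff_part_def by (intro Str_gl_bracket) auto
  then have "Str (Poly_Mapping.lookup (Poly_Mapping.single (k + l)
      (gl_bracket (Poly_Mapping.lookup f k) (Poly_Mapping.lookup g l))) 0) = 0" for k l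
    by (simp add: lookup_single when_def Str_0)
  then show ?thesis
    by (simp add: xy str_character_def aff_bracket_def lookup_add lookup_minus lookup_sum Str_add Str_diff Str_mscale Str_sum
        lookup_euler_0 Str_0)
qed

lemma one_dimensional_str_character: "one_dimensional (str_character s u)"
proof -
  interpret A: vector_space "ascale :: complex \<Rightarrow> 'a aff \<Rightarrow> 'a aff"
    by (rule vector_space_ascale)
  have add: "str_character s u (x + y) = str_character s u x + str_character s u y" for x y :: "'a aff"
    by (cases x, cases y) (simp add: str_character_def lookup_add Str_add Str_diff Str_mscale Str_sum algebra_simps)
  have scale: "str_character s u (ascale c x) = c * str_character s u x" for c and x :: "'a aff"
    by (cases x) (simp add: str_character_def ascale_def Str_add Str_diff Str_mscale Str_sum algebra_simps)
  have odd: "str_character s u x = 0" if "x \<in> aff_part True" for x :: "'a aff"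
  proof -
    obtain f c e where x: "x = (f, c, e)" by (cases x) auto
    have f: "gl_component True (Poly_Mapping.lookup f 0) = Poly_Mapping.lookup f 0" and e: "e = 0"
      using that by (auto simp: x aff_part_def)
    have "Poly_Mapping.lookup f 0 $ p $ p = 0" for p
      by (subst f[symmetric]) (simp add: gl_component_def)
    then show ?thesis by (simp add: x e str_character_def Str_eq_sum)
  qed
  show ?thesis
    unfolding one_dimensional_def aff_module_def
  proof (intro conjI allI ballI)
    show "vector_space ((*) :: complex \<Rightarrow> complex \<Rightarrow> complex)" ..
    show "module.subspace (*) (if a then {0} else UNIV :: complex set)" for a
      by (simp add: vector_space_over_itself.subspace_def)
    show "Vector_Spaces.linear (*) (*) ((*) (str_character s u x))" for x :: "'a aff"
      by unfold_locales (simp_all add: algebra_simps)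
    show "Vector_Spaces.linear ascale (*) (\<lambda>x :: 'a aff. str_character s u x * v)" for v
      by unfold_locales (simp_all add: add scale algebra_simps)
    show "str_character s u x * v \<in> (if a \<noteq> b then {0} else UNIV)"
      if "x \<in> aff_part a" "v \<in> (if b then {0} else UNIV)" for a b v and x :: "'a aff"
      using that odd by (cases a; cases b) auto
    show "str_character s u (aff_bracket x y) * v = str_character s u x * (str_character s u y * v)
        - of_real (super_sign a b) * (str_character s u y * (str_character s u x * v))"
      if xy: "x \<in> aff_part a" "y \<in> aff_part b" for a b v and x y :: "'a aff"
      using odd[of x] odd[of y] xy
      by (cases a; cases b) (auto simp: str_character_bracket[OF xy] super_sign_def)
  qed auto
qed

text \<open>A one-dimensional even module kills odd elements and brackets of homogeneous ones, so
  adding the scalar \<open>\<theta> x\<close> respects the module axioms.\<close>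

lemma (in aff_rep) tensor_one_module:
  assumes "one_dimensional \<theta>"
  shows "aff_rep sc P (tensor_one sc \<theta> \<rho>)"
proof -
  interpret T: aff_rep "(*)" "\<lambda>a. if a then {0} else UNIV" "\<lambda>x z. \<theta> x * z"
    using assms by unfold_locales (simp add: one_dimensional_def)
  have \<theta>_add: "\<theta> (x + y) = \<theta> x + \<theta> y" and \<theta>_scale: "\<theta> (ascale c x) = c * \<theta> x" for x y c
    using T.act_simps(5)[of x y 1] T.act_simps(7)[of c x 1] by simp_all
  have odd: "\<theta> x = 0" if "x \<in> aff_part True" for x
    using T.act_part[OF that, of 1 False] by simp
  have bracket: "\<theta> (aff_bracket x y) = 0" if xy: "x \<in> aff_part a" "y \<in> aff_part b" for a b x y
    using T.act_bracket[OF xy, of 1] odd[of x] odd[of y] xy by (cases a; cases b) (auto simp: super_sign_def)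
  interpret A: vector_space "ascale :: complex \<Rightarrow> 'n aff \<Rightarrow> 'n aff"
    by (rule vector_space_ascale)
  show ?thesis
    unfolding aff_rep_def aff_module_def
  proof (intro conjI allI ballI)
    show "vector_space sc" ..
    show "subspace (P a)" for a by (rule subspace_P)
    show "P False \<inter> P True = {0}"
      using P_disjoint subspace_0[OF subspace_P] by blast
    show "\<exists>v0\<in>P False. \<exists>v1\<in>P True. v = v0 + v1" for v by (rule P_decompose)
    show "Vector_Spaces.linear sc sc (tensor_one sc \<theta> \<rho> x)" for x
      by unfold_locales (simp_all add: tensor_one_def act_simps(1,3) scale_right_distrib mult.commute)
    show "Vector_Spaces.linear ascale sc (\<lambda>x. tensor_one sc \<theta> \<rho> x v)" for v
      by unfold_locales (simp_all add: tensor_one_def act_simps(5,7) \<theta>_add \<theta>_scale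
          scale_left_distrib scale_right_distrib)
    show "tensor_one sc \<theta> \<rho> x v \<in> P (a \<noteq> b)" if "x \<in> aff_part a" "v \<in> P b" for a b x v
    proof -
      have "sc (\<theta> x) v \<in> P (a \<noteq> b)"
        using that odd[of x] subspace_0[OF subspace_P] subspace_scale[OF subspace_P] by (cases a) auto
      then show ?thesis
        unfolding tensor_one_def by (intro subspace_add[OF subspace_P] act_part that)
    qed
    show "tensor_one sc \<theta> \<rho> (aff_bracket x y) v = tensor_one sc \<theta> \<rho> x (tensor_one sc \<theta> \<rho> y v)
        - sc (of_real (super_sign a b)) (tensor_one sc \<theta> \<rho> y (tensor_one sc \<theta> \<rho> x v))"
      if xy: "x \<in> aff_part a" "y \<in> aff_part b" for a b x y v
      using odd[of x] odd[of y] xy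
      by (cases a; cases b) (auto simp: tensor_one_def bracket[OF xy] act_bracket[OF xy] act_simps(1,3)
          super_sign_def scale_right_distrib mult.commute)
  qed
qed

text \<open>A subspace absorbs the scalars \<open>\<theta> x\<close>, so a graded submodule for the
  twisted action is one for \<open>\<rho>\<close>.\<close>

lemma tensor_one_irreducible:
  assumes irr: "irreducible_module sc P \<rho>" and \<theta>: "one_dimensional \<theta>"
  shows "irreducible_module sc P (tensor_one sc \<theta> \<rho>)"
proof -
  interpret aff_rep sc P \<rho>
    using irr by unfold_locales (simp add: irreducible_module_def)
  have "graded_submodule sc P \<rho> W" if W: "graded_submodule sc P (tensor_one sc \<theta> \<rho>) W" for W
  proof -
    have sub: "subspace W" using W by (simp add: graded_submodule_def)
    have "\<rho> x w \<in> W" if "w \<in> W" for x w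
    proof -
      have "tensor_one sc \<theta> \<rho> x w - sc (\<theta> x) w \<in> W"
        using W that unfolding graded_submodule_def
        by (intro subspace_diff[OF sub] subspace_scale[OF sub]) blast+
      then show ?thesis by (simp add: tensor_one_def)
    qed
    then show ?thesis using W unfolding graded_submodule_def by blast
  qed
  then show ?thesis
    using irr tensor_one_module[OF \<theta>] by (auto simp: irreducible_module_def aff_rep_def)
qed

text \<open>Gives the weight as an explicit function on the whole algebra, so that it can be
  compared for equality with members of \<open>listed_weights\<close>.\<close>

lemma (in aff_rep) highest_weight_vectorI:
  assumes "v \<noteq> 0" "\<And>x. x \<in> aff_nilradical B \<Longrightarrow> \<rho> x v = 0"
    and \<mu>: "\<And>p. \<rho> (loop (elem p p) 0) v = sc (\<mu> p) v"
    and "\<rho> central v = v" "\<rho> deriv_d v = 0"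
  shows "highest_weight_vector sc \<rho> B
    (\<lambda>(f, c, e). (\<Sum>p\<in>UNIV. Poly_Mapping.lookup f 0 $ p $ p * \<mu> p) + c) v"
  unfolding highest_weight_vector_def
proof (intro conjI ballI)
  fix h :: "'n aff" assume "h \<in> aff_cartan"
  then obtain H c e where h: "h = (Poly_Mapping.single 0 H, c, e)" and H: "\<And>p q. p \<noteq> q \<Longrightarrow> H $ p $ q = 0"
    by (auto simp: aff_cartan_def)
  have "\<rho> h v = (\<Sum>k\<in>Poly_Mapping.keys (Poly_Mapping.single (0::int) H). \<Sum>p\<in>UNIV. \<Sum>q\<in>UNIV.
      sc (Poly_Mapping.lookup (Poly_Mapping.single 0 H) k $ p $ q) (\<rho> (loop (elem p q) k) v)) + sc c v"
    unfolding h by (subst aff_decomposition) (simp add: act_simps assms)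
  also have "(\<Sum>k\<in>Poly_Mapping.keys (Poly_Mapping.single (0::int) H). \<Sum>p\<in>UNIV. \<Sum>q\<in>UNIV.
      sc (Poly_Mapping.lookup (Poly_Mapping.single 0 H) k $ p $ q) (\<rho> (loop (elem p q) k) v))
      = (\<Sum>p\<in>UNIV. \<Sum>q\<in>UNIV. sc (H $ p $ q) (\<rho> (loop (elem p q) 0) v))"
    by (cases "H = 0") simp_all
  also have "\<dots> = (\<Sum>p\<in>UNIV. \<Sum>q\<in>UNIV. if q = p then sc (H $ p $ p * \<mu> p) v else 0)"
    by (intro sum.cong refl) (auto simp: H \<mu>)
  also have "\<dots> + sc c v = sc ((\<Sum>p\<in>UNIV. H $ p $ p * \<mu> p) + c) v"
    by (simp add: scale_sum_left scale_left_distrib)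
  finally show "\<rho> h v = sc ((case h of (f, c, e) \<Rightarrow>
      (\<Sum>p\<in>UNIV. Poly_Mapping.lookup f 0 $ p $ p * \<mu> p) + c)) v"
    by (simp add: h)
qed (use assms in auto)

section \<open>Solving the conditions on the labels\<close>

lemma Nats_sum_0:
  assumes "x \<in> \<nat>" "y \<in> \<nat>" "x + y = (0 :: complex)"
  shows "x = 0"
proof -
  obtain m n where mn: "x = of_nat m" "y = of_nat n" using assms(1,2) by (auto elim!: Nats_cases)
  then have "of_nat (m + n) = (0 :: complex)" using assms(3) by simp
  then show ?thesis unfolding of_nat_eq_0_iff using mn by simp
qed

lemma Nats_sum_1:
  assumes "x \<in> \<nat>" "y \<in> \<nat>" "x + y = (1 :: complex)"
  shows "x = 0 \<or> x = 1"
proof -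
  obtain m n where mn: "x = of_nat m" "y = of_nat n" using assms(1,2) by (auto elim!: Nats_cases)
  then have "of_nat (m + n) = (of_nat 1 :: complex)" using assms(3) by simp
  then have "m + n = 1" unfolding of_nat_eq_iff .
  then have "m = 0 \<or> m = 1" by arith
  then show ?thesis using mn by auto
qed

lemma Min_less_Max:
  assumes "CARD('n::{finite,linorder}) \<ge> 2"
  shows "Min (UNIV :: 'n set) < Max UNIV"
proof (rule ccontr)
  assume "\<not> Min (UNIV :: 'n set) < Max UNIV"
  then have le: "Max UNIV \<le> Min (UNIV :: 'n set)" by (rule leI)
  have "i = Min UNIV" for i :: 'n
  proof (rule antisym)
    show "i \<le> Min UNIV" by (rule order_trans[OF Max_ge le]) auto
    show "Min UNIV \<le> i" by (rule Min_le) auto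
  qed
  then have "(UNIV :: 'n set) = {Min UNIV}" by blast
  then have "CARD('n) = 1" by (metis is_singletonI is_singleton_altdef)
  then show False using assms by simp
qed

text \<open>The numbers \<open>a i\<close> and \<open>b i\<close> are the values of an integrable weight of level 1 on $E_{ii}$ and
  $e_{ii}$.\<close>

lemma integrable_labels_cases:
  fixes a b :: "'n::{finite,linorder} \<Rightarrow> complex"
  assumes n: "CARD('n) \<ge> 2"
    and E: "\<And>i j. i < j \<Longrightarrow> a i - a j \<in> \<nat>" "\<And>i c j. i < c \<Longrightarrow> c \<le> j \<Longrightarrow> a i = a j \<Longrightarrow> a i + b c = 0"
    and F: "\<And>i j. i < j \<Longrightarrow> b i - b j \<in> \<nat>"
    and aff: "a (Max UNIV) - a (Min UNIV) + 1 \<in> \<nat>"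
      "a (Max UNIV) - a (Min UNIV) + 1 = 0 \<Longrightarrow> a (Max UNIV) + b (Min UNIV) + 1 = 0"
  defines "t \<equiv> a (Min UNIV)"
  obtains (pos) l :: nat where "\<And>i. a i = t" "\<And>i. b i = (if i = Min UNIV then of_nat l else 0) - t"
  | (neg) l :: nat where "\<And>i. a i = (if i = Max UNIV then - 1 else 0) + t"
      "\<And>i. b i = (if i = Max UNIV then - of_nat l else 0) - t"
proof -
  let ?m = "Min UNIV :: 'n" and ?M = "Max UNIV :: 'n"
  have m: "?m \<le> i" and M: "i \<le> ?M" for i
    by (auto intro: Min_le Max_ge)
  have mM: "?m < ?M"
    by (rule Min_less_Max[OF n])
  have m': "?m < i" if "i \<noteq> ?m" for i using le_neq_trans[OF m that[symmetric]] .
  have M': "i < ?M" if "i \<noteq> ?M" for i using le_neq_trans[OF M that] .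
  have split: "a i - a ?M \<in> \<nat>" "a ?m - a i \<in> \<nat>" for i
    using E(1)[OF m', of i] E(1)[OF M', of i] by (cases "i = ?m"; cases "i = ?M"; auto)+
  obtain l where l: "b ?m - b ?M = of_nat l"
    using F[OF mM] by (auto elim: Nats_cases)
  \<comment> \<open>This label and the affine one, \<open>a ?M - a ?m + 1\<close>, are natural and
    add up to the level 1.\<close>
  have "a ?m - a ?M = 0 \<or> a ?m - a ?M = 1"
    using Nats_sum_1[OF E(1)[OF mM] aff(1)] by simp
  then show ?thesis
  proof
    \<comment> \<open>The affine label is 1 and the labels inside the block vanish, so the odd
      labels force \<open>b i = - t\<close> except at \<open>?m\<close>.\<close>
    assume 0: "a ?m - a ?M = 0"
    have a: "a i = t" for i
      using Nats_sum_0[OF split(2)[of i] split(1)[of i]] 0 by (simp add: t_def)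
    have b: "b i = - t" if "i \<noteq> ?m" for i
      using E(2)[OF m'[OF that] order_refl] a by (metis add_eq_0_iff)
    show ?thesis
      using a b b[of ?M] l mM by (intro pos[of l]) (auto simp: algebra_simps)
  next
    \<comment> \<open>The affine label is 0, whence \<open>b ?m = - t\<close>; it remains to see
      that \<open>a\<close> drops only at \<open>?M\<close>.\<close>
    assume 1: "a ?m - a ?M = 1"
    then have bm: "b ?m = - t" "a ?M = t - 1"
      using aff(2) by (auto simp: t_def algebra_simps add_eq_0_iff)
    have a: "a i = t" if i: "i \<noteq> ?M" for i
    proof -
      \<comment> \<open>An earlier drop would make \<open>b ?M\<close> exceed \<open>b ?m\<close> by
        1, against dominance for the other block.\<close>
      have "a i \<noteq> a ?M"
      proof
        assume "a i = a ?M"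
        then have "b ?M = 1 - t"
          using E(2)[OF M'[OF i] order_refl] bm by (simp add: add_eq_0_iff)
        then have "b ?m - b ?M = - 1" using bm by simp
        then show False using F[OF mM] minus_one_in_Nats[where 'a = complex] by simp
      qed
      moreover have "a i - a ?M = 0 \<or> a i - a ?M = 1"
        by (rule Nats_sum_1[OF split(1)[of i] split(2)[of i]]) (use 1 in simp)
      ultimately show ?thesis using bm by auto
    qed
    have b: "b i = - t" if "i \<noteq> ?M" for i
    proof (cases "i = ?m")
      case False
      have "a ?m = a i" using a[OF that] by (simp add: t_def)
      then show ?thesis
        using E(2)[OF m'[OF False] order_refl] by (simp add: t_def add_eq_0_iff)
    qed (use bm in simp)
    have aM: "a ?M = - 1 + t" using bm by simp
    have "b ?M = b ?m - of_nat l" using l by (metis diff_diff_eq2 add_diff_cancel_left')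
    then have bM: "b ?M = - of_nat l - t" using bm by simp
    show ?thesis
      using a b aM bM by (intro neg[of l]) auto
  qed
qed

section \<open>Completeness of the list\<close>

text \<open>Splitting even roots into two odd ones yields the hypotheses of
  \<open>integrable_labels_cases\<close>; a supertrace twist then removes the common shift
  \<open>t\<close> and the eigenvalue of d.\<close>

lemma integrable_listed:
  fixes \<rho> :: "('n::{finite,linorder}) aff \<Rightarrow> 'v::ab_group_add \<Rightarrow> 'v"
  assumes n: "CARD('n) \<ge> 2" and L: "is_L sc P \<rho> \<Lambda>" and level: "level \<Lambda> = 1"
    and int: "integrable_module \<rho>"
  shows "\<exists>\<theta>. one_dimensional \<theta> \<and> (\<exists>\<Lambda>'\<in>listed_weights. is_L sc P (tensor_one sc \<theta> \<rho>) \<Lambda>')"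
proof -
  define X where "X p q k = \<rho> (loop (elem p q) k)" for p q k
  interpret level_one_rep sc X "\<rho> deriv_d" "P False \<union> P True"
    unfolding X_def by (rule is_L_level_one_rep[OF L level])
  have irr: "irreducible_module sc P \<rho>"
    using L by (simp add: is_L_def)
  obtain v where v: "v \<in> P False \<union> P True" "highest_weight_vector sc \<rho> nonstd_borel \<Lambda> v"
    using L by (auto simp: is_L_def)
  define \<mu> where "\<mu> p = \<Lambda> (loop (elem p p) 0)" for p
  have hw: "\<rho> h v = sc (\<Lambda> h) v" if "h \<in> aff_cartan" for h
    using v(2) that unfolding highest_weight_vector_def by blast
  have v0: "v \<noteq> 0" and wt: "X p p 0 v = sc (\<mu> p) v"
    and wt_d: "\<rho> deriv_d v = sc (\<Lambda> deriv_d) v" and wt_c: "\<rho> central v = v" for p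
    using v(2) hw[OF cartan_elements(1)] hw[OF cartan_elements(2)] hw[OF cartan_elements(3)] level
    by (simp_all add: highest_weight_vector_def X_def \<mu>_def level_def)
  have kill: "X p q k v = 0" if "k > 0 \<or> k = 0 \<and> nonstd_le p q" "p \<noteq> q \<or> k \<noteq> 0" for p q k
    using v(2) loop_elem_nilradical[OF that] by (auto simp: highest_weight_vector_def X_def)
  have nil: "locally_nilpotent (X (Inl i) (Inl j) k)" "locally_nilpotent (X (Inr i) (Inr j) 0)"
    if "i \<noteq> j" for i j k
    using int that by (auto simp: integrable_module_def X_def)
  \<comment> \<open>The root is split by f_c with e_i < f_c < e_j in the non-standard order.\<close>
  have E: "\<mu> (Inl i) - \<mu> (Inl j) \<in> \<nat>"
    "\<mu> (Inl i) = \<mu> (Inl j) \<Longrightarrow> \<mu> (Inl i) + \<mu> (Inr c) = 0" if "i < c" "c \<le> j" for i c j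
    using integrable_labels[of "Inl i" "Inl j" "Inr c" v \<mu> 0 0] that v0 wt nil(1)[of j i 0]
    by (auto simp: kill)
  have F: "\<mu> (Inr i) - \<mu> (Inr j) \<in> \<nat>" if "i < j" for i j
    using integrable_labels(1)[of "Inr i" "Inr j" "Inl i" v \<mu> 0 0] that v0 wt nil(2)[of j i]
    by (auto simp: kill)
  \<comment> \<open>The affine root vector, at row e_n and column e_1 with t^1, is split by f_1; the
    first factor carries the t.\<close>
  have aff: "\<mu> (Inl (Max UNIV)) - \<mu> (Inl (Min UNIV)) + 1 \<in> \<nat>"
    "\<mu> (Inl (Max UNIV)) - \<mu> (Inl (Min UNIV)) + 1 = 0 \<Longrightarrow>
      \<mu> (Inl (Max UNIV)) + \<mu> (Inr (Min UNIV)) + 1 = 0" if "Min UNIV \<noteq> (Max UNIV :: 'n)"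
    using integrable_labels[of "Inl (Max UNIV)" "Inl (Min UNIV)" "Inr (Min UNIV)" v \<mu> 1 0] that v0 wt
      nil(1)[of "Min UNIV" "Max UNIV" "- 1"]
    by (auto simp: kill supersign_def)
  have "Min UNIV \<noteq> (Max UNIV :: 'n)"
    using Min_less_Max[OF n] by (rule less_imp_neq)
  note aff = aff[OF this]
  define t where "t = \<mu> (Inl (Min UNIV))"
  \<comment> \<open>Adds \<open>- t\<close> to the values on the E_ii and \<open>t\<close> to those
    on the e_jj, and makes d kill \<open>v\<close>.\<close>
  define \<theta> :: "'n aff \<Rightarrow> complex" where "\<theta> = str_character (- t) (- \<Lambda> deriv_d)"
  have \<theta>: "one_dimensional \<theta>"
    unfolding \<theta>_def by (rule one_dimensional_str_character)
  have irr': "irreducible_module sc P (tensor_one sc \<theta> \<rho>)"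
    by (rule tensor_one_irreducible[OF irr \<theta>])
  interpret tw: aff_rep sc P "tensor_one sc \<theta> \<rho>"
    using irr' by unfold_locales (simp add: irreducible_module_def)
  have hw: "highest_weight_vector sc (tensor_one sc \<theta> \<rho>) nonstd_borel
      (\<lambda>(f, c, e). (\<Sum>p\<in>UNIV. Poly_Mapping.lookup f 0 $ p $ p * (\<mu> p - t * supersign p)) + c) v"
  proof (rule tw.highest_weight_vectorI[OF v0])
    fix x :: "'n aff" assume x: "x \<in> aff_nilradical nonstd_borel"
    then have "\<theta> x = 0"
      by (auto simp: aff_nilradical_def \<theta>_def str_character_def Str_eq_sum)
    then show "tensor_one sc \<theta> \<rho> x v = 0"
      using x v(2) by (simp add: tensor_one_def highest_weight_vector_def)
  next
    have "\<theta> (loop (elem p p) 0) = - t * supersign p" for p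
      by (simp add: \<theta>_def str_character_def loop_def Str_elem)
    then show "tensor_one sc \<theta> \<rho> (loop (elem p p) 0) v = sc (\<mu> p - t * supersign p) v" for p
      using wt[of p] by (simp add: tensor_one_def X_def scale_left_diff_distrib)
  next
    have "\<theta> central = 0" "\<theta> deriv_d = - \<Lambda> deriv_d"
      unfolding \<theta>_def str_character_def by (simp_all add: central_def deriv_d_def Str_0)
    then show "tensor_one sc \<theta> \<rho> central v = v" "tensor_one sc \<theta> \<rho> deriv_d v = 0"
      by (simp_all add: tensor_one_def wt_c wt_d)
  qed
  let ?\<Lambda> = "\<lambda>(f, c, e). (\<Sum>p\<in>UNIV. Poly_Mapping.lookup f 0 $ p $ p * (\<mu> p - t * supersign p)) + c"
  have "?\<Lambda> \<in> (listed_weights :: 'n weight set)"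
  proof (rule integrable_labels_cases[of "\<lambda>i. \<mu> (Inl i)" "\<lambda>i. \<mu> (Inr i)", OF n _ E(2) F aff, folded t_def])
    show "\<mu> (Inl i) - \<mu> (Inl j) \<in> \<nat>" if "i < j" for i j
      using E(1)[OF that order_refl] .
  next
    fix l :: nat
    assume a: "\<And>i. \<mu> (Inl i) = t" and b: "\<And>i. \<mu> (Inr i) = (if i = Min UNIV then of_nat l else 0) - t"
    have "\<mu> p - t * supersign p = (if p = Inr (Min UNIV) then of_nat l else 0)" for p
      by (cases p) (simp_all add: a b supersign_def)
    then have "?\<Lambda> = (\<lambda>h. of_int (int l) * delta (Min UNIV) h + Lambda0 h)"
      by (auto simp: delta_def Lambda0_def if_distrib[of "(*) _"] cong: if_cong)
    then show ?thesis
      unfolding listed_weights_def by (intro UnI1 CollectI exI conjI) (assumption, rule of_nat_0_le_iff)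
  next
    fix l :: nat
    assume a: "\<And>i. \<mu> (Inl i) = (if i = Max UNIV then - 1 else 0) + t"
      and b: "\<And>i. \<mu> (Inr i) = (if i = Max UNIV then - of_nat l else 0) - t"
    have "x * (\<mu> p - t * supersign p) = (if p = Inr (Max UNIV) then - (x * of_nat l) else 0)
        + (if p = Inl (Max UNIV) then - x else 0)" for p x
      by (cases p) (simp_all add: a b supersign_def)
    \<comment> \<open>The parameter in the second family is \<open>- int l - 1\<close>, which is
      negative; the final \<open>+ 1\<close> is the one in \<open>listed_weights\<close>.\<close>
    then have "?\<Lambda> = (\<lambda>h. of_int (- int l - 1 + 1) * delta (Max UNIV) h - eps (Max UNIV) h + Lambda0 h)"
      by (auto simp: delta_def eps_def Lambda0_def sum.distrib)
    then show ?thesis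
      unfolding listed_weights_def by (intro UnI2 CollectI exI conjI) (assumption, simp)
  qed
  then show ?thesis
    using \<theta> irr' hw v(1) by (auto simp: is_L_def)
qed

text \<open>For n = 1 there are no indices i \<noteq> j and integrability is an empty condition;
  completeness is therefore stated for n at least 2, and up to a one-dimensional twist.\<close>

theorem proposition5p1:
  fixes sc :: "complex \<Rightarrow> 'v::ab_group_add \<Rightarrow> 'v"
    and P :: "bool \<Rightarrow> 'v set"
    and \<rho> :: "('n::{finite,linorder}) aff \<Rightarrow> 'v \<Rightarrow> 'v"
  shows "(\<forall>\<Lambda>\<in>listed_weights. is_L sc P \<rho> \<Lambda> \<longrightarrow> integrable_module \<rho>) \<and>
         (CARD('n) \<ge> 2 \<longrightarrow>
           (\<forall>\<Lambda>. is_L sc P \<rho> \<Lambda> \<and> level \<Lambda> = 1 \<and> integrable_module \<rho> \<longrightarrow>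
             (\<exists>\<theta>. one_dimensional \<theta> \<and>
               (\<exists>\<Lambda>'\<in>listed_weights. is_L sc P (tensor_one sc \<theta> \<rho>) \<Lambda>'))))"
  using listed_integrable integrable_listed by blast

end
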